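(* For every integer $N\ge 1$, the polyhedron $(K_5)^N$ is not piecewise linearly embeddable into $\mathbb{R}^{2N}$, and the polyhedron $(K_{3,3})^N$ is not piecewise linearly embeddable into $\mathbb{R}^{2N}$.
   Context: $K_5$ is the complete graph on $5$ vertices and $K_{3,3}$ is the complete bipartite graph with $3$ vertices in each part, both viewed as compact $1$-dimensional polyhedra; $(K)^N$ denotes the Cartesian product of $N$ copies of $K$. A compact polyhedron $K$ is piecewise linearly embeddable into a polyhedron $L$ if there is an injective piecewise linear map $K\to L$; $\mathbb{R}^{d}$ is viewed as a non-compact polyhedron. *)

theory Defs
  imports "HOL-Analysis.Analysis"
begin

(* A compact polyhedron is the union of a finite simplicial complex in a Euclidean space.
   (The library's predicate polyhedron means a finite intersection of half-spaces,
   which is not what is meant by a polyhedron in piecewise linear topology.)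
   A map on a compact polyhedron is piecewise linear if it is affine on every simplex
   of some simplicial complex with that union.  Only the values of f on K matter. *)

definition pl_map_on :: "'a::euclidean_space set \<Rightarrow> ('a \<Rightarrow> 'b::euclidean_space) \<Rightarrow> bool" where
  "pl_map_on K f \<longleftrightarrow>
     (\<exists>\<C>. simplicial_complex \<C> \<and> \<Union>\<C> = K \<and>
        (\<forall>S\<in>\<C>. \<exists>h c. linear h \<and> (\<forall>x\<in>S. f x = h x + c)))"

definition pl_embeddable :: "'a::euclidean_space set \<Rightarrow> 'b::euclidean_space set \<Rightarrow> bool" where
  "pl_embeddable K L \<longleftrightarrow> (\<exists>f. pl_map_on K f \<and> inj_on f K \<and> f ` K \<subseteq> L)"

(* The vertices of the graph are realised as the standard basis vectors, so distinct edges
   meet at most in a common vertex. *)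

definition graph_polyhedron :: "'v::finite set set \<Rightarrow> (real ^ 'v) set" where
  "graph_polyhedron E =
     range (\<lambda>v. axis v 1) \<union> (\<Union>e\<in>E. convex hull ((\<lambda>v. axis v 1) ` e))"

definition K5 :: "(real ^ 5) set" where
  "K5 = graph_polyhedron {{u, v} | u v. u \<noteq> v}"

definition K33 :: "(real ^ (3 + 3)) set" where
  "K33 = graph_polyhedron {{Inl i, Inr j} | i j. True}"

definition cartesian_power :: "'a set \<Rightarrow> ('a ^ 'n::finite) set" where
  "cartesian_power K = {x. \<forall>i. x $ i \<in> K}"

end

(* For N = 1 this is the van Kampen obstruction: on the deleted product of K an embedding f into the
   plane would give the nowhere zero map f x - f y, odd under the swap T of the two factors.
   For all N the obstruction is carried by the following mod 2 chain.  There is a 2-cycle v in K x K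
   (a sum of products of two circles of K) such that v + T v is supported on pairs of disjoint edges,
   while on pairs of non-disjoint edges v is the symmetrisation of the three pairs of distinct edges of
   a tripod with centre p.  Then v^N + T v^N is a cycle in the deleted product of K^N.
   Peeling off one factor replaces v by the point (p, p) of the diagonal, so by induction on N this
   cycle has equivariant index 1.  On the other hand the signs of the 2 N coordinates of f x - f y on
   a fine cubical subdivision produce, by Fan's count of alternating simplices, antisymmetric cochains
   of all degrees on the deleted product that vanish in degree 2 N, so the index would be 0. *)

theory Submission
  imports Defs "HOL-Library.Z2"
begin

text \<open>Points of K^N x K^N are distinct as soon as one coordinate differs, so the deleted
  product is a union over the coordinates and not a product. Multiplying the case N = 1 is therefore
  not enough. What makes the induction work is the shape of the tripod part of v. Its six squares
  form a disc D around (p, p); T maps D to itself, and the boundary of D is a 12-gon of disjoint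
  cells on which T is the antipodal map. Hence v = d + D, where d is the disjoint part and has the
  same boundary as D, and v + T v = d + T d behaves like a 2-sphere with hemispheres d and T d. In
  K^N the disc D^N takes the role of D, and its centre, fixed by T, is what peeling uses. The degree
  2 N is tight: the coordinates of f x - f y provide 2 N pairs of opposite labels, so an alternating
  simplex has at most 2 N vertices, while a simplex of dimension 2 N has 2 N + 1.\<close>

section \<open>Chains and cochains modulo 2\<close>

(* Rewriting + to xor and - to + interferes with associative-commutative normalisation. *)
declare add_bit_eq_xor [simp del] minus_bit_def [simp del] uminus_bit_def [simp del]

lemma bit_add_self [simp]: "x + x = (0::bit)"
  by (cases x) simp_all

lemma bit_add_cancel [simp]: "x + (x + y) = (y::bit)"
  by (cases x; cases y) (simp_all add: add_bit_eq_xor)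

lemma bit_eq_iff_add_eq_0: "(x::bit) = y \<longleftrightarrow> x + y = 0"
  by (cases x; cases y) (simp_all add: add_bit_eq_xor)

(* A cell of a graph is a vertex (a, a) or an edge (a, b) with a and b distinct; a letter is a cell
   of K x K, and a word of N letters is a cell of K^N x K^N.  Chains are lists, to be read modulo 2. *)
type_synonym 'a cell = "'a \<times> 'a"
type_synonym 'a letter = "'a cell \<times> 'a cell"

definition cell_bd :: "'a cell \<Rightarrow> 'a cell list" where
  "cell_bd c = (if fst c = snd c then [] else [(fst c, fst c), (snd c, snd c)])"

definition bd :: "'a letter \<Rightarrow> 'a letter list" where
  "bd p = map (\<lambda>c. (c, snd p)) (cell_bd (fst p)) @ map (\<lambda>d. (fst p, d)) (cell_bd (snd p))"

(* A list of chains stands for their tensor product, on which ev evaluates the cochain u. *)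
fun ev :: "('p list \<Rightarrow> bit) \<Rightarrow> 'p list list \<Rightarrow> bit" where
  "ev u [] = u []"
| "ev u (a # as) = (\<Sum>x\<leftarrow>a. ev (\<lambda>w. u (x # w)) as)"

fun cobd :: "('a letter list \<Rightarrow> bit) \<Rightarrow> 'a letter list \<Rightarrow> bit" where
  "cobd u [] = 0"
| "cobd u (x # w) = (\<Sum>y\<leftarrow>bd x. u (y # w)) + cobd (\<lambda>w. u (x # w)) w"

lemma ev_cong:
  assumes "\<And>w. list_all2 (\<lambda>x a. x \<in> set a) w as \<Longrightarrow> u w = u' w"
  shows "ev u as = ev u' as"
  using assms
proof (induction as arbitrary: u u')
  case (Cons a as)
  have "ev (\<lambda>w. u (x # w)) as = ev (\<lambda>w. u' (x # w)) as" if "x \<in> set a" for x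
    using Cons.prems that by (intro Cons.IH) auto
  then show ?case
    by (simp cong: map_cong)
qed simp

lemma ev_zero [simp]: "ev (\<lambda>w. 0) as = 0"
  by (induction as) auto

lemma ev_add: "ev (\<lambda>w. u w + u' w) as = ev u as + ev u' as"
  by (induction as arbitrary: u u') (simp_all add: sum_list_addf)

lemma ev_sum_list: "ev (\<lambda>w. \<Sum>y\<leftarrow>ys. U y w) as = (\<Sum>y\<leftarrow>ys. ev (U y) as)"
  by (induction ys) (simp_all add: ev_add)

lemma ev_map: "ev u (map (map f) as) = ev (\<lambda>w. u (map f w)) as"
  by (induction as arbitrary: u) (simp_all add: o_def)

lemma sum_list_swap:
  "(\<Sum>x\<leftarrow>xs. \<Sum>y\<leftarrow>ys. f x y) = (\<Sum>y\<leftarrow>ys. \<Sum>x\<leftarrow>xs. f x y :: 'a::comm_monoid_add)"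
  by (induction xs) (simp_all add: sum_list_addf)

lemma bd_swap: "(\<Sum>y\<leftarrow>bd (prod.swap x). (g y :: bit)) = (\<Sum>y\<leftarrow>bd x. g (prod.swap y))"
  by (simp add: bd_def o_def add.commute)

lemma bd_swap_Nil [simp]: "bd (prod.swap x) = [] \<longleftrightarrow> bd x = []"
  by (auto simp: bd_def)

text \<open>A list may repeat a letter, so the vanishing of a chain modulo 2 is tested by summing
  every g over it.\<close>

definition cycle :: "'a letter list \<Rightarrow> bool" where
  "cycle v \<longleftrightarrow> (\<forall>g :: 'a letter \<Rightarrow> bit. (\<Sum>x\<leftarrow>v. \<Sum>y\<leftarrow>bd x. g y) = 0)"

lemma cycle_swap: "cycle v \<Longrightarrow> cycle (map prod.swap v)"
  by (simp add: cycle_def o_def bd_swap)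

text \<open>The coboundary is a sum over the positions of a word, and the summand for a position
  meets the boundary of the cycle standing there.\<close>

lemma ev_cobd_cycles:
  assumes "\<And>a. a \<in> set as \<Longrightarrow> cycle a"
  shows "ev (cobd u) as = 0"
  using assms
proof (induction as arbitrary: u)
  case (Cons a as)
  have "ev (cobd u) (a # as)
      = (\<Sum>x\<leftarrow>a. \<Sum>y\<leftarrow>bd x. ev (\<lambda>w. u (y # w)) as) + (\<Sum>x\<leftarrow>a. ev (cobd (\<lambda>w. u (x # w))) as)"
    by (simp add: ev_add ev_sum_list sum_list_addf)
  also have "(\<Sum>x\<leftarrow>a. \<Sum>y\<leftarrow>bd x. ev (\<lambda>w. u (y # w)) as) = 0"
    using Cons.prems by (simp add: cycle_def)
  also have "(\<Sum>x\<leftarrow>a. ev (cobd (\<lambda>w. u (x # w))) as) = 0"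
    using Cons by simp
  finally show ?case by simp
qed simp

section \<open>The deleted product and the index of the obstruction cycle\<close>

definition disjoint_cells :: "'a letter \<Rightarrow> bool" where
  "disjoint_cells p \<longleftrightarrow> {fst (fst p), snd (fst p)} \<inter> {fst (snd p), snd (snd p)} = {}"

lemma disjoint_cells_swap [simp]: "disjoint_cells (prod.swap p) \<longleftrightarrow> disjoint_cells p"
  by (auto simp: disjoint_cells_def)

(* The words with a disjoint letter form the deleted product of K^N.  The function u collects cochains
   u_k of all degrees with \delta u_k = (1 + T) u_(k+1) and (1 + T) u_0 = 1 there; the summand
   of_bool covers the second equation. *)
definition antisym_cochain :: "'a letter set \<Rightarrow> nat \<Rightarrow> ('a letter list \<Rightarrow> bit) \<Rightarrow> bool" where
  "antisym_cochain G n u \<longleftrightarrow>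
     (\<forall>w. length w = n \<longrightarrow> set w \<subseteq> G \<longrightarrow> (\<exists>x\<in>set w. disjoint_cells x) \<longrightarrow>
        cobd u w + of_bool (\<forall>x\<in>set w. bd x = []) = u w + u (map prod.swap w))"

text \<open>G is the set of admissible letters, closed under faces and under the swap. By
  \<open>v_dim\<close> a nonempty word of letters of v is never a vertex, which switches off the
  summand \<open>of_bool\<close> in \<open>antisym_cochain\<close>.\<close>

locale tripod_cycle =
  fixes G :: "'a letter set" and v :: "'a letter list" and p q1 q2 q3 :: 'a
  assumes distinct: "distinct [p, q1, q2, q3]"
    and G_bd: "x \<in> G \<Longrightarrow> set (bd x) \<subseteq> G"
    and G_swap: "x \<in> G \<Longrightarrow> prod.swap x \<in> G"
    and v_G: "set v \<subseteq> G"
    and v_dim: "x \<in> set v \<Longrightarrow> bd x \<noteq> []"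
    and tripod_G: "((p, q1), (p, q2)) \<in> G" "((p, q1), (p, q3)) \<in> G" "((p, q2), (p, q3)) \<in> G"
    and v_cycle: "cycle v"
    and v_split: "\<And>g :: 'a letter \<Rightarrow> bit. (\<Sum>x\<leftarrow>v. g x) = (\<Sum>x\<leftarrow>filter disjoint_cells v. g x)
        + g ((p, q1), (p, q2)) + g ((p, q1), (p, q3)) + g ((p, q2), (p, q3))
        + g ((p, q2), (p, q1)) + g ((p, q3), (p, q1)) + g ((p, q3), (p, q2))"
begin

lemma v_symmetric_off_disj:
  fixes g :: "'a letter \<Rightarrow> bit"
  assumes "\<And>x. disjoint_cells x \<Longrightarrow> g x = 0"
  shows "(\<Sum>x\<leftarrow>v. g x) = (\<Sum>x\<leftarrow>v. g (prod.swap x))"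
proof -
  have "(\<Sum>x\<leftarrow>filter disjoint_cells v. g x) = 0" "(\<Sum>x\<leftarrow>filter disjoint_cells v. g (prod.swap x)) = 0"
    using assms by (induction v) auto
  then show ?thesis
    using v_split[of g] v_split[of "\<lambda>x. g (prod.swap x)"] by (simp add: ac_simps)
qed

lemma words_in_G:
  assumes "list_all2 (\<lambda>x a. x \<in> set a) w (replicate n a)" "set a \<subseteq> G"
  shows "set w \<subseteq> G" "length w = n"
  using assms by (fastforce simp: list_all2_conv_all_nth in_set_conv_nth subset_iff)+

text \<open>In other words, v^n + T v^n lies in the deleted product. The first factor is swapped
  because only the tripod letters count there, and the others by induction.\<close>

lemma ev_symmetric_off_disj:
  assumes "\<And>w. length w = n \<Longrightarrow> set w \<subseteq> G \<Longrightarrow> \<exists>x\<in>set w. disjoint_cells x \<Longrightarrow> u w = 0"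
  shows "ev u (replicate n v) = ev u (replicate n (map prod.swap v))"
  using assms
proof (induction n arbitrary: u)
  case (Suc n)
  \<comment> \<open>\<open>v_symmetric_off_disj\<close> needs a function that vanishes at all
    disjoint letters, whereas \<open>u\<close> is controlled only on words over G; hence the value 0
    outside G.\<close>
  define k where "k x = (if x \<in> G then ev (\<lambda>w. u (x # w)) (replicate n v) else 0)" for x
  have sw: "set (map prod.swap v) \<subseteq> G"
    using v_G G_swap by auto
  have IH: "k x = ev (\<lambda>w. u (x # w)) (replicate n (map prod.swap v))" if "x \<in> G" for x
    unfolding k_def using that Suc.prems by (simp, intro Suc.IH) auto
  have "k x = 0" if "disjoint_cells x" for x
  proof (cases "x \<in> G")
    case True
    have "ev (\<lambda>w. u (x # w)) (replicate n v) = ev (\<lambda>w. 0) (replicate n v)"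
      using True that words_in_G[OF _ v_G] by (intro ev_cong Suc.prems) auto
    then show ?thesis by (simp add: k_def)
  qed (simp add: k_def)
  then have "(\<Sum>x\<leftarrow>v. k x) = (\<Sum>x\<leftarrow>map prod.swap v. k x)"
    using v_symmetric_off_disj[of k] by (simp add: o_def)
  moreover have "(\<Sum>x\<leftarrow>v. k x) = ev u (replicate (Suc n) v)"
    using v_G by (auto simp: k_def intro!: arg_cong[where f = sum_list])
  moreover have "(\<Sum>x\<leftarrow>map prod.swap v. k x) = ev u (replicate (Suc n) (map prod.swap v))"
    by (simp only: replicate_Suc ev.simps, intro arg_cong[where f = sum_list] map_cong refl)
      (use sw IH in blast)
  ultimately show ?case by simp
qed simp

(* With \<phi> and \<psi> the evaluations of u on x v^n and x T v^n, the relation for u yields relations a1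
   and a2 for disjoint letters x, and, since v^n + T v^n lives on the deleted product, relation b for
   their sum \<theta> at every letter x.  The rest is a diagram chase along the tripod. *)
lemma ev_antisym_cochain_Suc:
  assumes u: "antisym_cochain G (Suc n) u"
  shows "ev u (replicate (Suc n) v) + ev u (replicate (Suc n) (map prod.swap v)) =
    (if n = 0 then 1 else ev (\<lambda>w. u (((p, p), (p, p)) # w)) (replicate n v)
      + ev (\<lambda>w. u (((p, p), (p, p)) # w)) (replicate n (map prod.swap v)))"
proof -
  define V where "V = replicate n v"
  define W where "W = replicate n (map prod.swap v)"
  define \<phi> where "\<phi> x = ev (\<lambda>w. u (x # w)) V" for x
  define \<psi> where "\<psi> x = ev (\<lambda>w. u (x # w)) W" for x
  have sw: "set (map prod.swap v) \<subseteq> G"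
    using v_G G_swap by auto
  have W_V: "W = map (map prod.swap) V" and V_W: "V = map (map prod.swap) W"
    by (simp_all add: V_def W_def)
  have dim: "(\<forall>y\<in>set w. bd y = []) \<longleftrightarrow> n = 0"
    if "list_all2 (\<lambda>x a. x \<in> set a) w V \<or> list_all2 (\<lambda>x a. x \<in> set a) w W" for w
  proof -
    have "length w = n"
      using that by (auto simp: V_def W_def dest: list_all2_lengthD)
    moreover have "bd x \<noteq> []" if "x \<in> set w" for x
    proof -
      obtain i where i: "i < length w" "x = w ! i"
        using \<open>x \<in> set w\<close> by (auto simp: in_set_conv_nth)
      then have "x \<in> set v \<union> prod.swap ` set v"
        using \<open>_ \<or> _\<close> by (auto simp: V_def W_def list_all2_conv_all_nth)
      then show ?thesis
        using v_dim bd_swap_Nil by blast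
    qed
    ultimately show ?thesis
      by (cases w) auto
  qed
  have ev_of_bool: "ev (\<lambda>w. of_bool (bd x = [] \<and> (\<forall>y\<in>set w. bd y = []))) V = of_bool (n = 0 \<and> bd x = [])"
    "ev (\<lambda>w. of_bool (bd x = [] \<and> (\<forall>y\<in>set w. bd y = []))) W = of_bool (n = 0 \<and> bd x = [])" for x :: "'a letter"
  proof -
    show "ev (\<lambda>w. of_bool (bd x = [] \<and> (\<forall>y\<in>set w. bd y = []))) V = of_bool (n = 0 \<and> bd x = [])"
    proof (cases "n = 0")
      case False
      have "ev (\<lambda>w. of_bool (bd x = [] \<and> (\<forall>y\<in>set w. bd y = []))) V = ev (\<lambda>w. 0) V"
        using False dim by (intro ev_cong) auto
      then show ?thesis using False by simp
    qed (simp add: V_def)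
    show "ev (\<lambda>w. of_bool (bd x = [] \<and> (\<forall>y\<in>set w. bd y = []))) W = of_bool (n = 0 \<and> bd x = [])"
    proof (cases "n = 0")
      case False
      have "ev (\<lambda>w. of_bool (bd x = [] \<and> (\<forall>y\<in>set w. bd y = []))) W = ev (\<lambda>w. 0) W"
        using False dim by (intro ev_cong) auto
      then show ?thesis using False by simp
    qed (simp add: W_def)
  qed
  \<comment> \<open>The letters behind x run through cycles, so only the boundary of x
    survives.\<close>
  have bd_V: "ev (\<lambda>w. cobd u (x # w)) V = (\<Sum>y\<leftarrow>bd x. \<phi> y)" for x
  proof -
    have "ev (\<lambda>w. cobd u (x # w)) V = (\<Sum>y\<leftarrow>bd x. \<phi> y) + ev (cobd (\<lambda>w. u (x # w))) V"
      by (simp add: ev_add ev_sum_list \<phi>_def)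
    also have "ev (cobd (\<lambda>w. u (x # w))) V = 0"
      by (rule ev_cobd_cycles) (use v_cycle in \<open>auto simp: V_def\<close>)
    finally show ?thesis by simp
  qed
  have bd_W: "ev (\<lambda>w. cobd u (x # w)) W = (\<Sum>y\<leftarrow>bd x. \<psi> y)" for x
  proof -
    have "ev (\<lambda>w. cobd u (x # w)) W = (\<Sum>y\<leftarrow>bd x. \<psi> y) + ev (cobd (\<lambda>w. u (x # w))) W"
      by (simp add: ev_add ev_sum_list \<psi>_def)
    also have "ev (cobd (\<lambda>w. u (x # w))) W = 0"
      by (rule ev_cobd_cycles) (use cycle_swap[OF v_cycle] in \<open>auto simp: W_def\<close>)
    finally show ?thesis by simp
  qed
  have rhs_V: "ev (\<lambda>w. u (x # w) + u (map prod.swap (x # w))) V = \<phi> x + \<psi> (prod.swap x)" for x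
    by (simp add: ev_add \<phi>_def \<psi>_def W_V ev_map)
  have rhs_W: "ev (\<lambda>w. u (x # w) + u (map prod.swap (x # w))) W = \<psi> x + \<phi> (prod.swap x)" for x
    by (simp add: ev_add \<phi>_def \<psi>_def V_W ev_map del: map_map)
  have rel: "cobd u (x # w) + of_bool (bd x = [] \<and> (\<forall>y\<in>set w. bd y = [])) = u (x # w) + u (map prod.swap (x # w))"
    if "x \<in> G" "set w \<subseteq> G" "length w = n" "\<exists>y\<in>set (x # w). disjoint_cells y" for x w
  proof -
    have "length (x # w) = Suc n" "set (x # w) \<subseteq> G"
      using that by auto
    then have "cobd u (x # w) + of_bool (\<forall>y\<in>set (x # w). bd y = []) = u (x # w) + u (map prod.swap (x # w))"
      using u that(4) unfolding antisym_cochain_def by blast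
    then show ?thesis
      by (simp only: list.set ball_simps)
  qed
  have a1: "(\<Sum>y\<leftarrow>bd x. \<phi> y) + of_bool (n = 0 \<and> bd x = []) = \<phi> x + \<psi> (prod.swap x)"
    if "x \<in> G" "disjoint_cells x" for x
  proof -
    have "ev (\<lambda>w. cobd u (x # w) + of_bool (bd x = [] \<and> (\<forall>y\<in>set w. bd y = []))) V
        = ev (\<lambda>w. u (x # w) + u (map prod.swap (x # w))) V"
      using words_in_G[OF _ v_G] that unfolding V_def by (intro ev_cong rel) auto
    then show ?thesis
      by (simp only: ev_add[of "\<lambda>w. cobd u (x # w)"] bd_V rhs_V ev_of_bool)
  qed
  have a2: "(\<Sum>y\<leftarrow>bd x. \<psi> y) + of_bool (n = 0 \<and> bd x = []) = \<psi> x + \<phi> (prod.swap x)"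
    if "x \<in> G" "disjoint_cells x" for x
  proof -
    have "ev (\<lambda>w. cobd u (x # w) + of_bool (bd x = [] \<and> (\<forall>y\<in>set w. bd y = []))) W
        = ev (\<lambda>w. u (x # w) + u (map prod.swap (x # w))) W"
      using words_in_G[OF _ sw] that unfolding W_def by (intro ev_cong rel) auto
    then show ?thesis
      by (simp only: ev_add[of "\<lambda>w. cobd u (x # w)"] bd_W rhs_W ev_of_bool)
  qed
  define \<theta> where "\<theta> x = \<phi> x + \<psi> x" for x
  have b: "(\<Sum>y\<leftarrow>bd x. \<theta> y) = \<theta> x + \<theta> (prod.swap x)" if "x \<in> G" for x
  proof -
    \<comment> \<open>\<open>h w\<close> is the defect of the relation at \<open>x # w\<close>. It
      vanishes once w has a disjoint letter, so its values on V and W agree even if x is not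
      disjoint.\<close>
    define h where "h w = cobd u (x # w) + of_bool (bd x = [] \<and> (\<forall>y\<in>set w. bd y = []))
      + (u (x # w) + u (map prod.swap (x # w)))" for w
    have "ev h V = ev h W"
      unfolding V_def W_def
    proof (rule ev_symmetric_off_disj)
      fix w assume "length w = n" "set w \<subseteq> G" "\<exists>x\<in>set w. disjoint_cells x"
      then show "h w = 0"
        using that rel[of x w] unfolding h_def by (simp del: cobd.simps)
    qed
    then have "(\<Sum>y\<leftarrow>bd x. \<phi> y) + of_bool (n = 0 \<and> bd x = []) + (\<phi> x + \<psi> (prod.swap x))
        = (\<Sum>y\<leftarrow>bd x. \<psi> y) + of_bool (n = 0 \<and> bd x = []) + (\<psi> x + \<phi> (prod.swap x))"
      unfolding h_def by (simp only: ev_add[of "\<lambda>w. cobd u (x # w)"]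
        ev_add[of "\<lambda>w. cobd u (x # w) + _ w"] bd_W rhs_W bd_V rhs_V ev_of_bool)
    from iffD1[OF bit_eq_iff_add_eq_0 this] show ?thesis
      by (subst bit_eq_iff_add_eq_0) (simp add: \<theta>_def[abs_def] sum_list_addf ac_simps)
  qed
  have a_sum: "(\<Sum>x\<leftarrow>xs. \<Sum>y\<leftarrow>bd x. \<phi> y) = (\<Sum>x\<leftarrow>xs. \<phi> x) + (\<Sum>x\<leftarrow>xs. \<psi> (prod.swap x))"
    "(\<Sum>x\<leftarrow>xs. \<Sum>y\<leftarrow>bd x. \<psi> y) = (\<Sum>x\<leftarrow>xs. \<psi> x) + (\<Sum>x\<leftarrow>xs. \<phi> (prod.swap x))"
    if "\<And>x. x \<in> set xs \<Longrightarrow> x \<in> G \<and> disjoint_cells x \<and> bd x \<noteq> []" for xs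
  proof -
    have "(\<Sum>y\<leftarrow>bd x. \<phi> y) = \<phi> x + \<psi> (prod.swap x)" "(\<Sum>y\<leftarrow>bd x. \<psi> y) = \<psi> x + \<phi> (prod.swap x)"
      if "x \<in> set xs" for x
      using a1[of x] a2[of x] that \<open>\<And>x. x \<in> set xs \<Longrightarrow> _\<close> by auto
    then show "(\<Sum>x\<leftarrow>xs. \<Sum>y\<leftarrow>bd x. \<phi> y) = (\<Sum>x\<leftarrow>xs. \<phi> x) + (\<Sum>x\<leftarrow>xs. \<psi> (prod.swap x))"
      "(\<Sum>x\<leftarrow>xs. \<Sum>y\<leftarrow>bd x. \<psi> y) = (\<Sum>x\<leftarrow>xs. \<psi> x) + (\<Sum>x\<leftarrow>xs. \<phi> (prod.swap x))"
      by (simp_all add: sum_list_addf cong: map_cong)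
  qed
  define o' e1 e2 e3 k1 k2 k3 where "o' = (p, p)" and "e1 = (p, q1)" and "e2 = (p, q2)" and "e3 = (p, q3)"
    and "k1 = (q1, q1)" and "k2 = (q2, q2)" and "k3 = (q3, q3)"
  note names = o'_def e1_def e2_def e3_def k1_def k2_def k3_def
  have bds:
    "bd (e1, e2) = [(o', e2), (k1, e2), (e1, o'), (e1, k2)]" "bd (e2, e1) = [(o', e1), (k2, e1), (e2, o'), (e2, k1)]"
    "bd (e1, e3) = [(o', e3), (k1, e3), (e1, o'), (e1, k3)]" "bd (e3, e1) = [(o', e1), (k3, e1), (e3, o'), (e3, k1)]"
    "bd (e2, e3) = [(o', e3), (k2, e3), (e2, o'), (e2, k3)]" "bd (e3, e2) = [(o', e2), (k3, e2), (e3, o'), (e3, k2)]"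
    "bd (k1, e2) = [(k1, o'), (k1, k2)]" "bd (e1, k2) = [(o', k2), (k1, k2)]"
    "bd (k1, e3) = [(k1, o'), (k1, k3)]" "bd (e1, k3) = [(o', k3), (k1, k3)]"
    "bd (k2, e3) = [(k2, o'), (k2, k3)]" "bd (e2, k3) = [(o', k3), (k2, k3)]"
    "bd (o', e2) = [(o', o'), (o', k2)]" "bd (o', k2) = []"
    using distinct by (auto simp: bd_def cell_bd_def names)
  have inG: "(o', e2) \<in> G" "(e1, e2) \<in> G" "(e1, e3) \<in> G" "(e2, e3) \<in> G" "(k1, e2) \<in> G" "(e1, k2) \<in> G"
    "(k1, e3) \<in> G" "(e1, k3) \<in> G" "(k2, e3) \<in> G" "(e2, k3) \<in> G"
    using tripod_G G_bd[of "(e1, e2)"] G_bd[of "(e1, e3)"] G_bd[of "(e2, e3)"]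
    unfolding bds by (auto simp: names)
  have inG': "(o', k2) \<in> G"
    using G_bd[OF inG(1)] unfolding bds by simp
  have "(\<Sum>x\<leftarrow>v. \<Sum>y\<leftarrow>bd x. \<phi> y) = 0"
    using v_cycle by (simp add: cycle_def)
  moreover have zs: "(\<Sum>x\<leftarrow>filter disjoint_cells v. \<Sum>y\<leftarrow>bd x. \<phi> y)
    = (\<Sum>x\<leftarrow>filter disjoint_cells v. \<phi> x) + (\<Sum>x\<leftarrow>filter disjoint_cells v. \<psi> (prod.swap x))"
    using v_G v_dim by (intro a_sum) auto
  \<comment> \<open>As v is a cycle, its disjoint part has the same boundary as the tripod disc. The
    inner sides of the six squares cancel, and the twelve terms are the sides of the 12-gon.\<close>
  ultimately have z: "(\<Sum>x\<leftarrow>filter disjoint_cells v. \<phi> x) + (\<Sum>x\<leftarrow>filter disjoint_cells v. \<psi> (prod.swap x))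
    = \<phi> (k1, e2) + \<phi> (e1, k2) + \<phi> (k1, e3) + \<phi> (e1, k3) + \<phi> (k2, e3) + \<phi> (e2, k3)
      + \<phi> (e2, k1) + \<phi> (k2, e1) + \<phi> (e3, k1) + \<phi> (k3, e1) + \<phi> (e3, k2) + \<phi> (k3, e2)"
    using v_split[of "\<lambda>x. \<Sum>y\<leftarrow>bd x. \<phi> y"] zs
    unfolding names[symmetric] bds by (subst bit_eq_iff_add_eq_0) (simp add: subset_iff ac_simps)
  have b1: "\<psi> (k1, e2) + \<psi> (e1, k2) + \<psi> (k1, e3) + \<psi> (e1, k3) + \<psi> (k2, e3) + \<psi> (e2, k3)
      + \<phi> (e2, k1) + \<phi> (k2, e1) + \<phi> (e3, k1) + \<phi> (k3, e1) + \<phi> (e3, k2) + \<phi> (k3, e2)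
      = \<psi> (o', k2) + \<psi> (k2, o')"
  proof -
    \<comment> \<open>Half of the 12-gon: an arc from (p, q2) to its antipode (q2, p).\<close>
    define B where "B = [(k1, e2), (e1, k2), (k1, e3), (e1, k3), (k2, e3), (e2, k3)]"
    have "x \<in> G \<and> disjoint_cells x \<and> bd x \<noteq> []" if "x \<in> set B" for x
    proof -
      have "disjoint_cells x"
        using that distinct by (auto simp: B_def disjoint_cells_def names)
      then show ?thesis
        using that inG by (auto simp: B_def bds)
    qed
    from a_sum(2)[of B, OF this] show ?thesis
      by (simp add: B_def bds ac_simps)
  qed
  \<comment> \<open>The three squares in \<open>r\<close> form the half disc bounded by the arc
    \<open>B\<close> and by the diameter from (p, q2) through (p, p) to (q2, p); \<open>t\<close>
    treats one half of that diameter.\<close>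
  have r: "\<theta> (e1, e2) + \<theta> (e2, e1) = \<theta> (o', e2) + \<theta> (k1, e2) + \<theta> (e1, o') + \<theta> (e1, k2)"
    "\<theta> (e1, e3) + \<theta> (e3, e1) = \<theta> (o', e3) + \<theta> (k1, e3) + \<theta> (e1, o') + \<theta> (e1, k3)"
    "\<theta> (e2, e3) + \<theta> (e3, e2) = \<theta> (o', e3) + \<theta> (k2, e3) + \<theta> (e2, o') + \<theta> (e2, k3)"
    and t: "\<theta> (o', e2) + \<theta> (e2, o') = \<theta> (o', o') + \<theta> (o', k2)"
    using b[OF inG(2)] b[OF inG(3)] b[OF inG(4)] b[OF inG(1)] by (simp_all add: bds ac_simps)
  \<comment> \<open>An end of the arc is a disjoint vertex. Here alone the relation (1 + T) u_0 = 1
    contributes, namely when no further letters follow.\<close>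
  have b0: "\<phi> (o', k2) + \<psi> (k2, o') = of_bool (n = 0)"
  proof -
    have "disjoint_cells (o', k2)"
      using distinct by (auto simp: disjoint_cells_def names)
    from a1[OF inG' this] show ?thesis
      by (simp add: bds)
  qed
  have "ev u (replicate (Suc n) v) + ev u (replicate (Suc n) (map prod.swap v))
      = (\<Sum>x\<leftarrow>v. \<phi> x) + (\<Sum>x\<leftarrow>v. \<psi> (prod.swap x))"
    by (simp add: \<phi>_def \<psi>_def V_def W_def o_def)
  also have "\<dots> = (\<Sum>x\<leftarrow>filter disjoint_cells v. \<phi> x) + (\<Sum>x\<leftarrow>filter disjoint_cells v. \<psi> (prod.swap x))
      + (\<theta> (e1, e2) + \<theta> (e2, e1)) + (\<theta> (e1, e3) + \<theta> (e3, e1)) + (\<theta> (e2, e3) + \<theta> (e3, e2))"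
    unfolding v_split[of \<phi>] v_split[of "\<lambda>x. \<psi> (prod.swap x)"] names by (simp add: \<theta>_def ac_simps)
  also have "\<dots> = (\<psi> (k1, e2) + \<psi> (e1, k2) + \<psi> (k1, e3) + \<psi> (e1, k3) + \<psi> (k2, e3) + \<psi> (e2, k3)
      + \<phi> (e2, k1) + \<phi> (k2, e1) + \<phi> (e3, k1) + \<phi> (k3, e1) + \<phi> (e3, k2) + \<phi> (k3, e2))
      + (\<theta> (o', e2) + \<theta> (e2, o'))"
    unfolding z r by (simp add: \<theta>_def ac_simps)
  also have "\<dots> = \<phi> (o', k2) + \<psi> (k2, o') + \<theta> (o', o')"
    unfolding b1 t by (simp add: \<theta>_def ac_simps)
  also have "\<dots> = of_bool (n = 0) + \<theta> (o', o')"
    unfolding b0 ..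
  also have "\<dots> = (if n = 0 then 1 else \<theta> (o', o'))"
    by (auto simp: \<theta>_def \<phi>_def \<psi>_def V_def W_def)
  finally show ?thesis
    by (simp add: \<theta>_def \<phi>_def \<psi>_def V_def W_def o'_def)
qed

text \<open>The letter ((p, p), (p, p)) has no boundary and is fixed by the swap, so prefixing it to
  all words turns the cochain for n + 1 letters into one for n letters, until the last letter
  produces the 1.\<close>

lemma ev_antisym_cochain:
  assumes "antisym_cochain G n u" "n \<noteq> 0"
  shows "ev u (replicate n v) + ev u (replicate n (map prod.swap v)) = 1"
  using assms
proof (induction n arbitrary: u)
  case (Suc n)
  have "antisym_cochain G n (\<lambda>w. u (((p, p), (p, p)) # w))"
    unfolding antisym_cochain_def
  proof (intro allI impI)
    fix w assume w: "length w = n" "set w \<subseteq> G" "\<exists>x\<in>set w. disjoint_cells x"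
    have "((p, p), (p, q2)) \<in> G"
      using G_bd[OF tripod_G(1)] distinct by (simp add: bd_def cell_bd_def)
    then have "((p, p), (p, p)) \<in> G"
      using G_bd[of "((p, p), (p, q2))"] distinct by (simp add: bd_def cell_bd_def)
    then show "cobd (\<lambda>w. u (((p, p), p, p) # w)) w + of_bool (\<forall>x\<in>set w. bd x = []) =
        u (((p, p), p, p) # w) + u (((p, p), p, p) # map prod.swap w)"
      using Suc.prems(1)[unfolded antisym_cochain_def, rule_format, of "((p, p), (p, p)) # w"] w
      by (simp add: bd_def cell_bd_def)
  qed
  then show ?case
    unfolding ev_antisym_cochain_Suc[OF Suc.prems(1)] using Suc.IH by simp
qed simp

end

section \<open>The obstruction cycles of the two Kuratowski graphs\<close>

definition triangle :: "nat \<Rightarrow> nat \<Rightarrow> nat cell list" where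
  "triangle a b = [(0, a), (0, b), (a, b)]"

(* One product of triangles for each splitting of {1, 2, 3, 4} into two pairs. *)
definition K5_cycle :: "nat letter list" where
  "K5_cycle = List.product (triangle 1 2) (triangle 3 4) @ List.product (triangle 1 3) (triangle 2 4)
    @ List.product (triangle 1 4) (triangle 2 3)"

definition K5_cells :: "nat cell set" where
  "K5_cells = {(a, b). a \<le> b \<and> b < 5}"

(* The two parts of K33 are {0, 1, 2} and {3, 4, 5}. *)
definition square :: "nat \<Rightarrow> nat \<Rightarrow> nat cell list" where
  "square a b = [(0, 3), (0, b), (a, 3), (a, b)]"

definition K33_cycle :: "nat letter list" where
  "K33_cycle = List.product (square 1 4) (square 2 5) @ List.product (square 1 5) (square 2 4)"

definition K33_cells :: "nat cell set" where
  "K33_cells = {(a, b). a = b \<and> b < 6 \<or> a < 3 \<and> 3 \<le> b \<and> b < 6}"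

text \<open>The vertex 1 always lies in the first triangle. Each non-disjoint letter with the edge
  (0, 1) occurs in two of the three products and cancels; what remains are the ordered pairs of
  distinct edges from 0 to 2, 3, 4.\<close>

interpretation K5: tripod_cycle "K5_cells \<times> K5_cells" K5_cycle 0 2 3 4
proof
  show "cycle K5_cycle"
    unfolding cycle_def by (simp add: K5_cycle_def triangle_def bd_def cell_bd_def ac_simps)
  fix g :: "nat letter \<Rightarrow> bit"
  show "(\<Sum>x\<leftarrow>K5_cycle. g x) = (\<Sum>x\<leftarrow>filter disjoint_cells K5_cycle. g x)
        + g ((0, 2), (0, 3)) + g ((0, 2), (0, 4)) + g ((0, 3), (0, 4))
        + g ((0, 3), (0, 2)) + g ((0, 4), (0, 2)) + g ((0, 4), (0, 3))"
    by (simp add: K5_cycle_def triangle_def disjoint_cells_def ac_simps)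
qed (auto simp: K5_cells_def K5_cycle_def triangle_def bd_def cell_bd_def split: if_splits)

text \<open>The two products share four non-disjoint letters, with (0, 3) or (1, 3) in the first
  place and (0, 3) or (2, 3) in the second. These cancel and leave the tripod from 0 to 3, 4,
  5.\<close>

interpretation K33: tripod_cycle "K33_cells \<times> K33_cells" K33_cycle 0 3 4 5
proof
  show "cycle K33_cycle"
    unfolding cycle_def by (simp add: K33_cycle_def square_def bd_def cell_bd_def ac_simps)
  fix g :: "nat letter \<Rightarrow> bit"
  show "(\<Sum>x\<leftarrow>K33_cycle. g x) = (\<Sum>x\<leftarrow>filter disjoint_cells K33_cycle. g x)
        + g ((0, 3), (0, 4)) + g ((0, 3), (0, 5)) + g ((0, 4), (0, 5))
        + g ((0, 4), (0, 3)) + g ((0, 5), (0, 3)) + g ((0, 5), (0, 4))"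
    by (simp add: K33_cycle_def square_def disjoint_cells_def ac_simps)
qed (auto simp: K33_cells_def K33_cycle_def square_def bd_def cell_bd_def split: if_splits)

section \<open>Alternating simplices and cubes\<close>

fun face_sum :: "('a list \<Rightarrow> bit) \<Rightarrow> 'a list \<Rightarrow> bit" where
  "face_sum u [] = 0"
| "face_sum u (x # l) = u l + face_sum (\<lambda>l. u (x # l)) l"

lemma face_sum_cong:
  assumes "\<And>l'. Suc (length l') = length l \<Longrightarrow> u l' = u' l'"
  shows "face_sum u l = face_sum u' l"
  using assms
proof (induction l arbitrary: u u')
  case (Cons x l)
  have "face_sum (\<lambda>l. u (x # l)) l = face_sum (\<lambda>l. u' (x # l)) l"
    using Cons.prems by (intro Cons.IH) auto
  then show ?case
    using Cons.prems[of l] by simp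
qed simp

lemma face_sum_zero [simp]: "face_sum (\<lambda>l. 0) l = 0"
  by (induction l) auto

lemma face_sum_map: "face_sum (\<lambda>l. u (map f l)) l = face_sum u (map f l)"
  by (induction l arbitrary: u) simp_all

text \<open>Leibniz rule for a join: the omitted entry belongs to exactly one of the two
  sublists.\<close>

lemma face_sum_filter:
  "face_sum (\<lambda>l. H (filter P l) (filter (\<lambda>x. \<not> P x) l)) l =
     face_sum (\<lambda>c. H c (filter (\<lambda>x. \<not> P x) l)) (filter P l)
     + face_sum (\<lambda>c. H (filter P l) c) (filter (\<lambda>x. \<not> P x) l)"
proof (induction l arbitrary: H)
  case (Cons x l)
  show ?case
    using Cons[of "\<lambda>c. H (x # c)"] Cons[of "\<lambda>c l. H c (x # l)"] by (simp add: ac_simps)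
qed simp

(* The labels (j, s) with j < d are the vertices of the boundary of the cross-polytope in R^d, and
   neg is the antipodal map.  fan d l is 1 iff the signs of l, ordered by increasing j, are
   +, -, +, ...; it is defined by writing the cross-polytope as an iterated suspension, c being the
   list of entries of l that are apices. *)
fun suspend :: "((nat \<times> bool) list \<Rightarrow> bit) \<Rightarrow> (nat \<times> bool) list \<Rightarrow> (nat \<times> bool) list \<Rightarrow> bit" where
  "suspend u [] l = u l"
| "suspend u [s] l = (if snd s = even (length l) then u l else 0)"
| "suspend u (s # t # c) l = 0"

lemma suspend_Nil [simp]: "suspend u [] = u"
  by (rule ext) simp

lemma suspend_Cons_Cons [simp]: "suspend u (s # t # c) = (\<lambda>l. 0)"
  by (rule ext) simp

fun fan :: "nat \<Rightarrow> (nat \<times> bool) list \<Rightarrow> bit" where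
  "fan 0 l = of_bool (l = [])"
| "fan (Suc d) l = suspend (fan d) (filter (\<lambda>s. fst s = d) l) (filter (\<lambda>s. fst s \<noteq> d) l)"

definition neg :: "nat \<times> bool \<Rightarrow> nat \<times> bool" where
  "neg s = (fst s, \<not> snd s)"

lemma fst_neg [simp]: "fst (neg s) = fst s" and snd_neg [simp]: "snd (neg s) = (\<not> snd s)"
  by (simp_all add: neg_def)

lemma fan_eq_0: "d < length l \<Longrightarrow> fan d l = 0"
proof (induction d arbitrary: l)
  case (Suc d)
  have len: "length l = length (filter (\<lambda>s. fst s = d) l) + length (filter (\<lambda>s. fst s \<noteq> d) l)"
    using sum_length_filter_compl[of "\<lambda>s. fst s = d" l] by simp
  show ?case
    by (cases "(fan d, filter (\<lambda>s. fst s = d) l, l)" rule: suspend.cases)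
      (use len Suc in auto)
qed simp

text \<open>The local step of Fan's count, by induction along the suspensions. The number of apices
  decides: none reduces to d, one compares the sign of the apex with a parity, two cancel, and with
  more every face still has two.\<close>

lemma face_sum_fan:
  assumes "\<And>s. s \<in> set l \<Longrightarrow> fst s < d" "\<And>s. s \<in> set l \<Longrightarrow> neg s \<notin> set l"
  shows "face_sum (fan d) l = fan d l + fan d (map neg l)"
  using assms
proof (induction d arbitrary: l)
  case 0
  then show ?case by (cases l) auto
next
  case (Suc d)
  define c where "c = filter (\<lambda>s. fst s = d) l"
  define l' where "l' = filter (\<lambda>s. fst s \<noteq> d) l"
  have IH: "face_sum (fan d) l' = fan d l' + fan d (map neg l')"
  proof (rule Suc.IH)
    fix s assume s: "s \<in> set l'"
    then show "fst s < d"
      using Suc.prems(1)[of s] by (auto simp: l'_def)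
    show "neg s \<notin> set l'"
      using s Suc.prems(2)[of s] by (auto simp: l'_def)
  qed
  have neg_c: "filter (\<lambda>s. fst s = d) (map neg l) = map neg c"
    "filter (\<lambda>s. fst s \<noteq> d) (map neg l) = map neg l'"
    by (simp_all add: c_def l'_def filter_map o_def)
  have lhs: "face_sum (fan (Suc d)) l = face_sum (\<lambda>c. suspend (fan d) c l') c
      + face_sum (\<lambda>l'. suspend (fan d) c l') l'"
    using face_sum_filter[of "suspend (fan d)" "\<lambda>s. fst s = d" l] by (simp add: c_def l'_def fan.simps(2)[abs_def])
  have rhs: "fan (Suc d) l + fan (Suc d) (map neg l) = suspend (fan d) c l' + suspend (fan d) (map neg c) (map neg l')"
    unfolding fan.simps neg_c by (simp add: c_def l'_def)
  consider "c = []" | s where "c = [s]" | s t where "c = [s, t]" | s t r x where "c = s # t # r # x"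
    by (metis list.exhaust)
  then show ?case
  proof cases
    case 1
    then show ?thesis unfolding lhs rhs using IH by simp
  next
    case 2
    \<comment> \<open>Omitting a vertex below the apex flips the parity that the sign of the apex
      has to match.\<close>
    have eq: "face_sum (\<lambda>l'. suspend (fan d) c l') l'
        = face_sum (\<lambda>x. if snd s = odd (length l') then fan d x else 0) l'"
    proof (rule face_sum_cong)
      fix x :: "(nat \<times> bool) list" assume "Suc (length x) = length l'"
      then have "even (length x) \<longleftrightarrow> odd (length l')"
        by (metis even_Suc)
      then show "suspend (fan d) c x = (if snd s = odd (length l') then fan d x else 0)"
        using 2 by simp
    qed
    then show ?thesis
      unfolding lhs rhs eq using IH 2 by (auto simp: ac_simps)
  next
    case 3
    then have "s \<in> set c" "t \<in> set c"
      by simp_all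
    then have "s \<in> set l" "t \<in> set l" "fst s = d" "fst t = d"
      by (simp_all add: c_def)
    moreover have "t \<noteq> neg s"
      using Suc.prems(2)[of s] \<open>s \<in> set l\<close> \<open>t \<in> set l\<close> by auto
    \<comment> \<open>Antipodal labels are excluded, so two apices have equal signs and the two
      faces that omit one of them cancel.\<close>
    ultimately have "snd s = snd t"
      by (auto simp: prod_eq_iff)
    then show ?thesis
      unfolding lhs rhs using 3 by simp
  next
    case 4
    have "face_sum (\<lambda>c. suspend (fan d) c l') c = face_sum (\<lambda>c. 0) c"
    proof (rule face_sum_cong)
      fix y :: "(nat \<times> bool) list" assume "Suc (length y) = length c"
      then show "suspend (fan d) y l' = 0"
        by (cases "(fan d, y, l')" rule: suspend.cases) (use 4 in auto)
    qed
    then show ?thesis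
      unfolding lhs rhs using 4 by simp
  qed
qed

(* Sum of h over the maximal monotone vertex paths from x that move each coordinate i in S once, to
   b i: these are the top simplices of Kuhn's triangulation of a cube.  The first argument is card S. *)
primrec path_sum ::
    "nat \<Rightarrow> ('k \<Rightarrow> 'a) \<Rightarrow> (('k \<Rightarrow> 'a) list \<Rightarrow> bit) \<Rightarrow> ('k \<Rightarrow> 'a) \<Rightarrow> 'k set \<Rightarrow> bit" where
  "path_sum 0 b h x S = h [x]"
| "path_sum (Suc n) b h x S = (\<Sum>i\<in>S. path_sum n b (\<lambda>l. h (x # l)) (x(i := b i)) (S - {i}))"

lemma path_sum_add: "path_sum n b (\<lambda>l. h l + h' l) x S = path_sum n b h x S + path_sum n b h' x S"
  by (induction n arbitrary: h h' x S) (simp_all add: sum.distrib)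

lemma path_sum_cong:
  assumes "card S = n" "finite S"
    and "\<And>l. length l = Suc n \<Longrightarrow> (\<And>y. y \<in> set l \<Longrightarrow> (\<forall>k. y k = x k \<or> k \<in> S \<and> y k = b k)) \<Longrightarrow> h l = h' l"
    and "\<And>k. k \<in> S \<Longrightarrow> b k = b' k"
  shows "path_sum n b h x S = path_sum n b' h' x S"
  using assms
proof (induction n arbitrary: h h' x S)
  case 0
  then show ?case
    using "0.prems"(3)[of "[x]"] by simp
next
  case (Suc n)
  have "path_sum n b (\<lambda>l. h (x # l)) (x(i := b i)) (S - {i})
      = path_sum n b' (\<lambda>l. h' (x # l)) (x(i := b i)) (S - {i})" if "i \<in> S" for i
  proof (rule Suc.IH)
    show "card (S - {i}) = n" "finite (S - {i})"
      using Suc.prems that by auto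
    fix l :: "('a \<Rightarrow> 'b) list"
    assume l: "length l = Suc n" "\<And>y. y \<in> set l \<Longrightarrow> \<forall>k. y k = (x(i := b i)) k \<or> k \<in> S - {i} \<and> y k = b k"
    show "h (x # l) = h' (x # l)"
    proof (rule Suc.prems(3))
      fix y assume "y \<in> set (x # l)"
      then show "\<forall>k. y k = x k \<or> k \<in> S \<and> y k = b k"
        using l(2)[of y] that by (auto split: if_splits)
    qed (use l in simp)
  qed (use Suc.prems in auto)
  then show ?case
    using Suc.prems(4) by simp
qed

lemma sum_offdiag_symmetric:
  fixes F :: "'k \<Rightarrow> 'k \<Rightarrow> bit"
  assumes "finite S" "\<And>i j. i \<noteq> j \<Longrightarrow> F i j = F j i"
  shows "(\<Sum>i\<in>S. \<Sum>j\<in>S - {i}. F i j) = 0"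
  using assms(1)
proof induction
  case (insert k S)
  have "(\<Sum>i\<in>insert k S. \<Sum>j\<in>insert k S - {i}. F i j)
      = (\<Sum>j\<in>S. F k j) + (\<Sum>i\<in>S. \<Sum>j\<in>insert k (S - {i}). F i j)"
  proof -
    have "insert k S - {i} = insert k (S - {i})" if "i \<in> S" for i
      using that insert.hyps by auto
    moreover have "insert k S - {k} = S"
      using insert.hyps by auto
    ultimately show ?thesis
      using insert by simp
  qed
  also have "(\<Sum>i\<in>S. \<Sum>j\<in>insert k (S - {i}). F i j) = (\<Sum>i\<in>S. F k i) + (\<Sum>i\<in>S. \<Sum>j\<in>S - {i}. F i j)"
    unfolding sum.distrib[symmetric] using insert by (intro sum.cong) (auto intro: assms(2))
  finally show ?case
    using insert by simp
qed simp

(* Removing an inner vertex of a path gives a simplex that is shared with exactly one other path. *)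
lemma path_sum_face_sum:
  assumes "card S = n" "finite S"
  shows "path_sum n b (face_sum h) x S + (if n = 0 then h [] else 0)
    = (\<Sum>i\<in>S. path_sum (n - 1) b h (x(i := b i)) (S - {i}) + path_sum (n - 1) b h x (S - {i}))"
  using assms
proof (induction n arbitrary: h x S)
  case 0
  then show ?case by simp
next
  case (Suc n)
  define h' where "h' l = h (x # l)" for l
  have split: "path_sum (Suc n) b (face_sum h) x S
      = (\<Sum>i\<in>S. path_sum n b h (x(i := b i)) (S - {i}))
        + (\<Sum>i\<in>S. path_sum n b (face_sum h') (x(i := b i)) (S - {i}))"
    by (simp add: path_sum_add sum.distrib h'_def[abs_def])
  have "(\<Sum>i\<in>S. path_sum n b (face_sum h') (x(i := b i)) (S - {i})) = (\<Sum>i\<in>S. path_sum n b h x (S - {i}))"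
  proof (cases n)
    case 0
    then obtain i where "S = {i}"
      using Suc.prems by (metis One_nat_def card_1_singletonE)
    then show ?thesis
      using 0 by (simp add: h'_def)
  next
    case (Suc m)
    have "(\<Sum>i\<in>S. path_sum n b (face_sum h') (x(i := b i)) (S - {i}))
        = (\<Sum>i\<in>S. \<Sum>j\<in>S - {i}. path_sum m b h' (x(i := b i, j := b j)) (S - {i} - {j})
            + path_sum m b h' (x(i := b i)) (S - {i} - {j}))"
    proof (intro sum.cong refl)
      fix i assume "i \<in> S"
      then have "card (S - {i}) = n" "finite (S - {i})"
        using Suc.prems by auto
      from Suc.IH[OF this, of h' "x(i := b i)"]
      show "path_sum n b (face_sum h') (x(i := b i)) (S - {i})
        = (\<Sum>j\<in>S - {i}. path_sum m b h' (x(i := b i, j := b j)) (S - {i} - {j})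
            + path_sum m b h' (x(i := b i)) (S - {i} - {j}))"
        by (simp only: \<open>n = Suc m\<close> nat.simps if_False add_0_right diff_Suc_1)
    qed
    also have "\<dots> = (\<Sum>i\<in>S. \<Sum>j\<in>S - {i}. path_sum m b h' (x(i := b i, j := b j)) (S - {i} - {j}))
        + (\<Sum>i\<in>S. \<Sum>j\<in>S - {i}. path_sum m b h' (x(i := b i)) (S - {i} - {j}))"
      by (simp add: sum.distrib)
    \<comment> \<open>These terms omit the vertex between the first two moves i and j; the other
      order of the moves gives the same simplex.\<close>
    also have "(\<Sum>i\<in>S. \<Sum>j\<in>S - {i}. path_sum m b h' (x(i := b i, j := b j)) (S - {i} - {j})) = 0"
    proof (rule sum_offdiag_symmetric)
      fix i j :: 'a assume "i \<noteq> j"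
      then show "path_sum m b h' (x(i := b i, j := b j)) (S - {i} - {j})
          = path_sum m b h' (x(j := b j, i := b i)) (S - {j} - {i})"
        by (simp add: fun_upd_twist Diff_insert2[symmetric] insert_commute)
    qed (use Suc.prems in auto)
    \<comment> \<open>Here the last vertex is omitted, so axis j is never moved. For fixed j, i runs
      over the first moves of the paths in the lower j-face.\<close>
    also have "(\<Sum>i\<in>S. \<Sum>j\<in>S - {i}. path_sum m b h' (x(i := b i)) (S - {i} - {j}))
        = (\<Sum>j\<in>S. \<Sum>i\<in>S - {j}. path_sum m b h' (x(i := b i)) (S - {j} - {i}))"
    proof -
      have "S - {i} = {j. j \<in> S \<and> i \<noteq> j}" "S - {i} = {j. j \<in> S \<and> j \<noteq> i}" for i
        by auto
      moreover have "S - {i} - {j} = S - {j} - {i}" for i j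
        by auto
      ultimately show ?thesis
        using sum.swap_restrict[of S S "\<lambda>i j. path_sum m b h' (x(i := b i)) (S - {i} - {j})" "(\<noteq>)"] Suc.prems
        by (metis (no_types, lifting) sum.cong)
    qed
    also have "\<dots> = (\<Sum>j\<in>S. path_sum n b h x (S - {j}))"
      using Suc by (simp add: h'_def[abs_def])
    finally show ?thesis
      by (simp only: add_0_left)
  qed
  then show ?case
    by (simp only: split sum.distrib nat.simps if_False add_0_right diff_Suc_1)
qed

text \<open>Paths move the axes in all orders, so Kuhn's triangulation does not depend on a
  numbering of the axes. This makes \<open>cube_sum\<close> compatible with the swap of the two
  factors.\<close>

lemma path_sum_reindex:
  assumes "\<And>k. \<tau> (\<tau> k) = k"
  shows "path_sum n (b \<circ> \<tau>) h (x \<circ> \<tau>) (\<tau> ` S) = path_sum n b (\<lambda>l. h (map (\<lambda>y. y \<circ> \<tau>) l)) x S"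
proof (induction n arbitrary: h x S)
  case (Suc n)
  have inj: "inj_on \<tau> S"
    by (rule inj_on_inverseI[of _ \<tau>]) (rule assms)
  have "path_sum n (b \<circ> \<tau>) (\<lambda>l. h ((x \<circ> \<tau>) # l)) ((x \<circ> \<tau>)(\<tau> i := b (\<tau> (\<tau> i)))) (\<tau> ` S - {\<tau> i})
      = path_sum n b (\<lambda>l. h ((x \<circ> \<tau>) # map (\<lambda>y. y \<circ> \<tau>) l)) (x(i := b i)) (S - {i})" if "i \<in> S" for i
  proof -
    have "(x \<circ> \<tau>)(\<tau> i := b (\<tau> (\<tau> i))) = x(i := b i) \<circ> \<tau>"
      using assms by (auto simp: fun_eq_iff)
    moreover have "\<tau> ` S - {\<tau> i} = \<tau> ` (S - {i})"
      using assms by (metis (no_types, lifting) image_empty image_insert image_set_diff inj_on_inverseI)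
    ultimately show ?thesis
      by (simp only: Suc.IH)
  qed
  then have "(\<Sum>i\<in>S. path_sum n (b \<circ> \<tau>) (\<lambda>l. h ((x \<circ> \<tau>) # l)) ((x \<circ> \<tau>)(\<tau> i := b (\<tau> (\<tau> i)))) (\<tau> ` S - {\<tau> i}))
      = path_sum (Suc n) b (\<lambda>l. h (map (\<lambda>y. y \<circ> \<tau>) l)) x S"
    by (simp only: path_sum.simps list.map cong: sum.cong)
  moreover have "path_sum (Suc n) (b \<circ> \<tau>) h (x \<circ> \<tau>) (\<tau> ` S)
      = (\<Sum>i\<in>S. path_sum n (b \<circ> \<tau>) (\<lambda>l. h ((x \<circ> \<tau>) # l)) ((x \<circ> \<tau>)(\<tau> i := b (\<tau> (\<tau> i)))) (\<tau> ` S - {\<tau> i}))"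
    unfolding path_sum.simps sum.reindex[OF inj] by (simp add: comp_def)
  ultimately show ?case
    by (simp only:)
qed simp

(* A word of n letters is a cube with axes (i, b), i < n, where b selects the second factor. *)
definition coord :: "'a letter list \<Rightarrow> nat \<times> bool \<Rightarrow> 'a cell" where
  "coord w k = (if fst k < length w then (if snd k then snd else fst) (w ! fst k) else undefined)"

definition lower :: "'a letter list \<Rightarrow> nat \<times> bool \<Rightarrow> 'a" where
  "lower w k = fst (coord w k)"

definition upper :: "'a letter list \<Rightarrow> nat \<times> bool \<Rightarrow> 'a" where
  "upper w k = snd (coord w k)"

definition axes :: "'a letter list \<Rightarrow> (nat \<times> bool) set" where
  "axes w = {k. fst k < length w \<and> lower w k \<noteq> upper w k}"

definition vertices :: "'a letter list \<Rightarrow> (nat \<times> bool \<Rightarrow> 'a) set" where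
  "vertices w = {y. \<forall>k. y k = lower w k \<or> k \<in> axes w \<and> y k = upper w k}"

definition cube_sum :: "((nat \<times> bool \<Rightarrow> 'a) list \<Rightarrow> bit) \<Rightarrow> 'a letter list \<Rightarrow> bit" where
  "cube_sum h w = path_sum (card (axes w)) (upper w) h (lower w) (axes w)"

definition put :: "bool \<Rightarrow> 'a cell \<Rightarrow> 'a letter \<Rightarrow> 'a letter" where
  "put b c p = (if b then (fst p, c) else (c, snd p))"

definition face :: "nat \<times> bool \<Rightarrow> 'a \<Rightarrow> 'a letter list \<Rightarrow> 'a letter list" where
  "face k a w = w[fst k := put (snd k) (a, a) (w ! fst k)]"

lemma finite_axes [simp]: "finite (axes w)"
proof (rule finite_subset)
  show "axes w \<subseteq> {..<length w} \<times> UNIV"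
    by (auto simp: axes_def)
qed simp

lemma coord_face:
  assumes "fst k < length w"
  shows "coord (face k a w) = (coord w)(k := (a, a))"
  using assms by (auto simp: fun_eq_iff coord_def face_def put_def nth_list_update prod_eq_iff)

lemma axes_face:
  assumes "k \<in> axes w"
  shows "axes (face k a w) = axes w - {k}" "lower (face k a w) = (lower w)(k := a)"
    "upper (face k a w) = (upper w)(k := a)"
proof -
  have *: "coord (face k a w) = (coord w)(k := (a, a))"
    using assms by (intro coord_face) (simp add: axes_def)
  show l: "lower (face k a w) = (lower w)(k := a)" and u: "upper (face k a w) = (upper w)(k := a)"
    by (auto simp: lower_def upper_def * fun_eq_iff)
  show "axes (face k a w) = axes w - {k}"
    unfolding axes_def l u by (auto simp: face_def)
qed

lemma cobd_eq_sum: "cobd u w = (\<Sum>i<length w. \<Sum>y\<leftarrow>bd (w ! i). u (w[i := y]))"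
proof (induction w arbitrary: u)
  case (Cons x w)
  show ?case
    unfolding cobd.simps Cons length_Cons sum.lessThan_Suc_shift by simp
qed simp

lemma cobd_eq_sum_axes:
  "cobd u w = (\<Sum>k\<in>axes w. u (face k (upper w k) w) + u (face k (lower w k) w))"
proof -
  define F where "F k = u (face k (upper w k) w) + u (face k (lower w k) w)" for k
  have "(\<Sum>y\<leftarrow>bd (w ! i). u (w[i := y])) = (\<Sum>b\<in>UNIV. if (i, b) \<in> axes w then F (i, b) else 0)"
    if "i < length w" for i
    using that by (simp add: UNIV_bool F_def bd_def cell_bd_def axes_def lower_def upper_def coord_def
        face_def put_def ac_simps)
  then have "cobd u w = (\<Sum>i<length w. \<Sum>b\<in>UNIV. if (i, b) \<in> axes w then F (i, b) else 0)"
    unfolding cobd_eq_sum by simp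
  also have "\<dots> = (\<Sum>k\<in>{..<length w} \<times> UNIV. if k \<in> axes w then F k else 0)"
    unfolding sum.cartesian_product by (intro sum.cong) auto
  also have "\<dots> = (\<Sum>k\<in>({..<length w} \<times> UNIV) \<inter> axes w. F k)"
    by (simp add: sum.inter_restrict)
  also have "({..<length w} \<times> UNIV) \<inter> axes w = axes w"
    by (auto simp: axes_def)
  finally show ?thesis
    by (simp add: F_def)
qed

lemma cube_sum_cong:
  assumes "\<And>l. length l = Suc (card (axes w)) \<Longrightarrow> set l \<subseteq> vertices w \<Longrightarrow> h l = h' l"
  shows "cube_sum h w = cube_sum h' w"
  unfolding cube_sum_def by (rule path_sum_cong) (use assms in \<open>auto simp: vertices_def subset_iff\<close>)

lemma cube_sum_add: "cube_sum (\<lambda>l. h l + h' l) w = cube_sum h w + cube_sum h' w"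
  by (simp add: cube_sum_def path_sum_add)

lemma cube_sum_face:
  assumes "k \<in> axes w"
  shows "cube_sum h (face k a w) = path_sum (card (axes w) - 1) (upper w) h ((lower w)(k := a)) (axes w - {k})"
  unfolding cube_sum_def axes_face[OF assms] using assms
  by (simp, intro path_sum_cong) auto

text \<open>\<open>face_sum\<close> is augmented: the only face of a point is the empty list. A
  0-cube has no boundary, and the extra term compensates for that; for Fan's cochain it becomes the
  equation (1 + T) u_0 = 1.\<close>

lemma cobd_cube_sum:
  "cobd (cube_sum h) w = cube_sum (face_sum h) w + (if axes w = {} then h [] else 0)"
proof -
  have "cobd (cube_sum h) w
      = (\<Sum>k\<in>axes w. path_sum (card (axes w) - 1) (upper w) h ((lower w)(k := upper w k)) (axes w - {k})
          + path_sum (card (axes w) - 1) (upper w) h (lower w) (axes w - {k}))"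
    unfolding cobd_eq_sum_axes by (intro sum.cong refl) (simp only: cube_sum_face fun_upd_triv)
  also have "\<dots> = path_sum (card (axes w)) (upper w) (face_sum h) (lower w) (axes w)
      + (if card (axes w) = 0 then h [] else 0)"
    by (subst path_sum_face_sum) auto
  finally show ?thesis
    by (simp add: cube_sum_def)
qed

section \<open>Fan's cochains on cubes and the swap of the two factors\<close>

definition flip :: "nat \<times> bool \<Rightarrow> nat \<times> bool" where
  "flip k = (fst k, \<not> snd k)"

lemma flip_flip [simp]: "flip (flip k) = k"
  by (simp add: flip_def)

lemma cube_sum_swap:
  "cube_sum h (map prod.swap w) = cube_sum (\<lambda>l. h (map (\<lambda>y. y \<circ> flip) l)) w"
proof -
  \<comment> \<open>Out of range \<open>coord\<close> takes one and the same default, so the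
    equation holds there too.\<close>
  have c: "coord (map prod.swap w) = coord w \<circ> flip"
    by (auto simp: fun_eq_iff coord_def flip_def)
  have l: "lower (map prod.swap w) = lower w \<circ> flip" and u: "upper (map prod.swap w) = upper w \<circ> flip"
    by (auto simp: fun_eq_iff lower_def upper_def c)
  have a: "axes (map prod.swap w) = flip ` axes w"
  proof -
    have "k \<in> axes (map prod.swap w) \<longleftrightarrow> flip k \<in> axes w" for k
      by (simp add: axes_def l u) (simp add: flip_def)
    moreover have "k \<in> flip ` axes w \<longleftrightarrow> flip k \<in> axes w" for k
      by (auto intro: image_eqI[of _ flip "flip k"])
    ultimately show ?thesis
      by blast
  qed
  have "card (flip ` axes w) = card (axes w)"
    by (intro card_image inj_on_inverseI[of _ flip]) simp
  then show ?thesis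
    unfolding cube_sum_def l u a by (simp only: path_sum_reindex[OF flip_flip])
qed

lemma axes_empty_iff: "axes w = {} \<longleftrightarrow> (\<forall>x\<in>set w. bd x = [])"
proof
  assume *: "axes w = {}"
  show "\<forall>x\<in>set w. bd x = []"
  proof
    fix x assume "x \<in> set w"
    then obtain i where "i < length w" "x = w ! i"
      by (auto simp: in_set_conv_nth)
    then have "(i, b) \<notin> axes w" for b
      using * by auto
    from this[of True] this[of False] show "bd x = []"
      using \<open>i < length w\<close> \<open>x = w ! i\<close>
      by (simp add: axes_def lower_def upper_def coord_def bd_def cell_bd_def)
  qed
next
  assume "\<forall>x\<in>set w. bd x = []"
  then have "fst (coord w k) = snd (coord w k)" if "fst k < length w" for k
    using that nth_mem[OF that] by (auto simp: coord_def bd_def cell_bd_def split: if_splits)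
  then show "axes w = {}"
    by (auto simp: axes_def lower_def upper_def)
qed

text \<open>Without antipodal labels on its corners, a cube maps simplexwise to the boundary of the
  cross-polytope, and the relation of \<open>face_sum_fan\<close> is pulled back along this
  map.\<close>

lemma cobd_cube_sum_fan:
  assumes "\<And>y. y \<in> vertices w \<Longrightarrow> fst (\<Lambda> y) < d"
    and "\<And>y. y \<in> vertices w \<Longrightarrow> \<Lambda> (y \<circ> flip) = neg (\<Lambda> y)"
    and "\<And>y z. y \<in> vertices w \<Longrightarrow> z \<in> vertices w \<Longrightarrow> \<Lambda> z \<noteq> neg (\<Lambda> y)"
  defines "u \<equiv> cube_sum (\<lambda>l. fan d (map \<Lambda> l))"
  shows "cobd u w + of_bool (\<forall>x\<in>set w. bd x = []) = u w + u (map prod.swap w)"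
proof -
  have fan_Nil: "fan d [] = 1"
    by (induction d) auto
  have "cobd u w + of_bool (\<forall>x\<in>set w. bd x = []) = cube_sum (face_sum (\<lambda>l. fan d (map \<Lambda> l))) w"
    by (simp add: u_def cobd_cube_sum axes_empty_iff fan_Nil)
  also have "\<dots> = cube_sum (\<lambda>l. fan d (map \<Lambda> l) + fan d (map \<Lambda> (map (\<lambda>y. y \<circ> flip) l))) w"
  proof (rule cube_sum_cong)
    fix l :: "(nat \<times> bool \<Rightarrow> 'a) list" assume l: "set l \<subseteq> vertices w"
    have "face_sum (fan d) (map \<Lambda> l) = fan d (map \<Lambda> l) + fan d (map neg (map \<Lambda> l))"
      using l assms(1,3) by (intro face_sum_fan) (auto, metis subsetD)
    also have "map neg (map \<Lambda> l) = map \<Lambda> (map (\<lambda>y. y \<circ> flip) l)"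
      using l assms(2) by auto
    finally show "face_sum (\<lambda>l. fan d (map \<Lambda> l)) l = fan d (map \<Lambda> l) + fan d (map \<Lambda> (map (\<lambda>y. y \<circ> flip) l))"
      by (simp only: face_sum_map)
  qed
  finally show ?thesis
    by (simp add: cube_sum_add u_def cube_sum_swap)
qed

lemma cube_sum_fan_eq_0:
  assumes "d \<le> card (axes w)"
  shows "cube_sum (\<lambda>l. fan d (map \<Lambda> l)) w = 0"
proof -
  have "path_sum n b (\<lambda>l. 0) x S = 0" for n and b x :: "nat \<times> bool \<Rightarrow> 'a" and S
    by (induction n arbitrary: x S) simp_all
  moreover have "cube_sum (\<lambda>l. fan d (map \<Lambda> l)) w = cube_sum (\<lambda>l. 0) w"
    using assms by (intro cube_sum_cong fan_eq_0) simp
  ultimately show ?thesis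
    by (simp add: cube_sum_def)
qed

section \<open>Subdivision\<close>

lemma cobd_sum_list: "cobd (\<lambda>w. \<Sum>z\<leftarrow>zs. U z w) w = (\<Sum>z\<leftarrow>zs. cobd (U z) w)"
proof (induction w arbitrary: U)
  case (Cons x w)
  show ?case
    unfolding cobd.simps Cons by (simp add: sum_list_addf sum_list_swap[of _ "bd x"])
qed simp

text \<open>A chain map on letters induces one on words, letter by letter, and pulling back cochains
  along a chain map commutes with the coboundary.\<close>

lemma cobd_ev:
  assumes "\<And>x g. x \<in> set w \<Longrightarrow> (\<Sum>z\<leftarrow>s x. \<Sum>y\<leftarrow>bd z. g y) = (\<Sum>y\<leftarrow>bd x. \<Sum>z\<leftarrow>s y. (g z :: bit))"
  shows "cobd (\<lambda>w. ev u (map s w)) w = ev (cobd u) (map s w)"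
  using assms
proof (induction w arbitrary: u)
  case (Cons x w)
  have "cobd (\<lambda>w. ev u (map s w)) (x # w)
      = (\<Sum>y\<leftarrow>bd x. \<Sum>z\<leftarrow>s y. ev (\<lambda>w. u (z # w)) (map s w)) + (\<Sum>z\<leftarrow>s x. ev (cobd (\<lambda>w. u (z # w))) (map s w))"
    using Cons by (simp add: cobd_sum_list)
  also have "(\<Sum>y\<leftarrow>bd x. \<Sum>z\<leftarrow>s y. ev (\<lambda>w. u (z # w)) (map s w))
      = (\<Sum>z\<leftarrow>s x. \<Sum>y\<leftarrow>bd z. ev (\<lambda>w. u (y # w)) (map s w))"
    using Cons.prems[of x] by simp
  finally show ?case
    by (simp add: ev_add ev_sum_list sum_list_addf)
qed simp

lemma ev_map_letters:
  assumes "\<And>x g. x \<in> set w \<Longrightarrow> (\<Sum>z\<leftarrow>s (t x). g z) = (\<Sum>z\<leftarrow>s x. (g (t' z) :: bit))"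
  shows "ev u (map s (map t w)) = ev (\<lambda>w. u (map t' w)) (map s w)"
  using assms by (induction w arbitrary: u) simp_all

lemma sum_list_product: "(\<Sum>z\<leftarrow>List.product A B. g z) = (\<Sum>c\<leftarrow>A. \<Sum>d\<leftarrow>B. (g (c, d) :: 'a::comm_monoid_add))"
  by (induction A) (simp_all add: o_def)

text \<open>The small cells are again pairs of end points, now points of the ambient space, so
  \<open>bd\<close>, \<open>cobd\<close> and \<open>cube_sum\<close> apply to them
  unchanged.\<close>

definition subdivide :: "nat \<Rightarrow> ('a \<Rightarrow> 'b::real_vector) \<Rightarrow> 'a cell \<Rightarrow> 'b cell list" where
  "subdivide m pt c = (if fst c = snd c then [(pt (fst c), pt (fst c))]
     else map (\<lambda>j. (pt (fst c) + (real j / real m) *\<^sub>R (pt (snd c) - pt (fst c)),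
                    pt (fst c) + (real (Suc j) / real m) *\<^sub>R (pt (snd c) - pt (fst c)))) [0..<m])"

definition subdivide_letter :: "nat \<Rightarrow> ('a \<Rightarrow> 'b::real_vector) \<Rightarrow> 'a letter \<Rightarrow> 'b letter list" where
  "subdivide_letter m pt p = List.product (subdivide m pt (fst p)) (subdivide m pt (snd p))"

lemma subdivide_nondegenerate:
  assumes "z \<in> set (subdivide m pt c)" "fst c \<noteq> snd c \<Longrightarrow> pt (fst c) \<noteq> pt (snd c)"
  shows "fst z = snd z \<longleftrightarrow> fst c = snd c"
  using assms by (auto simp: subdivide_def divide_simps split: if_splits)

text \<open>The sum telescopes modulo 2. The points must differ because \<open>cell_bd\<close>
  recognises an edge by its distinct ends.\<close>

lemma bd_subdivide:
  fixes g :: "'b::real_vector cell \<Rightarrow> bit"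
  assumes "m > 0" "fst c \<noteq> snd c \<Longrightarrow> pt (fst c) \<noteq> pt (snd c)"
  shows "(\<Sum>z\<leftarrow>subdivide m pt c. \<Sum>y\<leftarrow>cell_bd z. g y) = (\<Sum>y\<leftarrow>cell_bd c. \<Sum>z\<leftarrow>subdivide m pt y. g z)"
proof (cases "fst c = snd c")
  case False
  define a where "a j = pt (fst c) + (real j / real m) *\<^sub>R (pt (snd c) - pt (fst c))" for j
  have telescope: "(\<Sum>j\<leftarrow>[0..<n]. g (a j, a j) + g (a (Suc j), a (Suc j))) = g (a 0, a 0) + g (a n, a n)" for n
    by (induction n) (simp_all add: ac_simps)
  have sub: "subdivide m pt c = map (\<lambda>j. (a j, a (Suc j))) [0..<m]"
    using False by (simp add: subdivide_def a_def)
  have "a j \<noteq> a (Suc j)" if "j < m" for j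
    using subdivide_nondegenerate[of "(a j, a (Suc j))" m pt c] assms(2) False that by (auto simp: sub)
  then have "(\<Sum>z\<leftarrow>subdivide m pt c. \<Sum>y\<leftarrow>cell_bd z. g y)
      = (\<Sum>j\<leftarrow>[0..<m]. g (a j, a j) + g (a (Suc j), a (Suc j)))"
    unfolding sub by (auto simp: cell_bd_def o_def intro!: arg_cong[where f = sum_list])
  then show ?thesis
    unfolding telescope using False assms(1) by (simp add: cell_bd_def subdivide_def a_def)
qed (simp add: subdivide_def cell_bd_def)

lemma sum_bd: "(\<Sum>y\<leftarrow>bd p. g y) = (\<Sum>c\<leftarrow>cell_bd (fst p). g (c, snd p)) + (\<Sum>d\<leftarrow>cell_bd (snd p). (g (fst p, d) :: bit))"
  by (simp add: bd_def o_def)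

lemma bd_subdivide_letter:
  fixes g :: "'b::real_vector letter \<Rightarrow> bit"
  assumes "m > 0" "\<And>c. c = fst p \<or> c = snd p \<Longrightarrow> fst c \<noteq> snd c \<Longrightarrow> pt (fst c) \<noteq> pt (snd c)"
  shows "(\<Sum>z\<leftarrow>subdivide_letter m pt p. \<Sum>y\<leftarrow>bd z. g y) = (\<Sum>y\<leftarrow>bd p. \<Sum>z\<leftarrow>subdivide_letter m pt y. g z)"
proof -
  let ?A = "subdivide m pt (fst p)" and ?B = "subdivide m pt (snd p)"
  have "(\<Sum>z\<leftarrow>subdivide_letter m pt p. \<Sum>y\<leftarrow>bd z. g y)
      = (\<Sum>d\<leftarrow>?B. \<Sum>c\<leftarrow>?A. \<Sum>y\<leftarrow>cell_bd c. g (y, d)) + (\<Sum>c\<leftarrow>?A. \<Sum>d\<leftarrow>?B. \<Sum>y\<leftarrow>cell_bd d. g (c, y))"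
    unfolding subdivide_letter_def sum_list_product sum_bd fst_conv snd_conv sum_list_addf
    by (simp only: sum_list_swap[of _ ?B ?A])
  also have "(\<Sum>d\<leftarrow>?B. \<Sum>c\<leftarrow>?A. \<Sum>y\<leftarrow>cell_bd c. g (y, d))
      = (\<Sum>y\<leftarrow>cell_bd (fst p). \<Sum>c\<leftarrow>subdivide m pt y. \<Sum>d\<leftarrow>?B. g (c, d))"
    using bd_subdivide[of m "fst p" pt "\<lambda>c. \<Sum>d\<leftarrow>?B. g (c, d)"] assms
    by (simp add: sum_list_swap[of _ ?B])
  also have "(\<Sum>c\<leftarrow>?A. \<Sum>d\<leftarrow>?B. \<Sum>y\<leftarrow>cell_bd d. g (c, y))
      = (\<Sum>y\<leftarrow>cell_bd (snd p). \<Sum>c\<leftarrow>?A. \<Sum>d\<leftarrow>subdivide m pt y. g (c, d))"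
    using bd_subdivide[of m "snd p" pt] assms
    by (simp add: sum_list_swap[of _ "cell_bd (snd p)" ?A])
  finally show ?thesis
    unfolding sum_bd subdivide_letter_def sum_list_product fst_conv snd_conv .
qed

lemma subdivide_letter_swap:
  "(\<Sum>z\<leftarrow>subdivide_letter m pt (prod.swap p). g z) = (\<Sum>z\<leftarrow>subdivide_letter m pt p. (g (prod.swap z) :: bit))"
  by (simp add: subdivide_letter_def sum_list_product) (rule sum_list_swap)

lemma subdivide_letter_degenerate_iff:
  assumes "z \<in> set (subdivide_letter m pt p)"
    and "\<And>c. c = fst p \<or> c = snd p \<Longrightarrow> fst c \<noteq> snd c \<Longrightarrow> pt (fst c) \<noteq> pt (snd c)"
  shows "fst (fst z) = snd (fst z) \<longleftrightarrow> fst (fst p) = snd (fst p)"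
    and "fst (snd z) = snd (snd z) \<longleftrightarrow> fst (snd p) = snd (snd p)"
proof -
  have "fst z \<in> set (subdivide m pt (fst p))" "snd z \<in> set (subdivide m pt (snd p))"
    using assms(1) by (auto simp: subdivide_letter_def)
  then show "fst (fst z) = snd (fst z) \<longleftrightarrow> fst (fst p) = snd (fst p)"
    and "fst (snd z) = snd (snd z) \<longleftrightarrow> fst (snd p) = snd (snd p)"
    using subdivide_nondegenerate[of "fst z" m pt "fst p"] subdivide_nondegenerate[of "snd z" m pt "snd p"] assms(2)
    by auto
qed

text \<open>Disjointness refers to the coarse letters. Small cells near the diagonal can be disjoint
  as well, but there the images under f are not kept apart, so the relation is demanded only over
  coarse words in the deleted product.\<close>

lemma antisym_cochain_subdivide:
  fixes pt :: "'a \<Rightarrow> 'b::real_vector"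
  assumes "m > 0"
    and pt: "\<And>p c. p \<in> G \<Longrightarrow> c = fst p \<or> c = snd p \<Longrightarrow> fst c \<noteq> snd c \<Longrightarrow> pt (fst c) \<noteq> pt (snd c)"
    and u: "\<And>w w'. length w = n \<Longrightarrow> set w \<subseteq> G \<Longrightarrow> \<exists>x\<in>set w. disjoint_cells x \<Longrightarrow>
      list_all2 (\<lambda>z p. z \<in> set (subdivide_letter m pt p)) w' w \<Longrightarrow>
      cobd u w' + of_bool (\<forall>x\<in>set w'. bd x = []) = u w' + u (map prod.swap w')"
  shows "antisym_cochain G n (\<lambda>w. ev u (map (subdivide_letter m pt) w))"
  unfolding antisym_cochain_def
proof (intro allI impI)
  fix w assume w: "length w = n" "set w \<subseteq> G" "\<exists>x\<in>set w. disjoint_cells x"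
  let ?s = "subdivide_letter m pt"
  have dim: "(\<forall>x\<in>set w'. bd x = []) \<longleftrightarrow> (\<forall>x\<in>set w. bd x = [])"
    if "list_all2 (\<lambda>z p. z \<in> set (?s p)) w' w" for w'
  proof -
    have "bd z = [] \<longleftrightarrow> bd p = []" if "z \<in> set (?s p)" "p \<in> set w" for z p
    proof -
      have "p \<in> G"
        using that w by auto
      from subdivide_letter_degenerate_iff[OF that(1) pt[OF this]] show ?thesis
        by (simp add: bd_def cell_bd_def)
    qed
    then have "bd (w' ! i) = [] \<longleftrightarrow> bd (w ! i) = []" if "i < length w" for i
      using \<open>list_all2 _ w' w\<close> that by (auto simp: list_all2_conv_all_nth)
    then show ?thesis
      using list_all2_lengthD[OF that] by (simp add: all_set_conv_all_nth)
  qed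
  \<comment> \<open>A vertex letter has a single part. Otherwise the sum would count m or m^2 parts
    modulo 2.\<close>
  have one: "ev (\<lambda>w. 1) (map ?s w) = 1" if "\<forall>x\<in>set w. bd x = []"
  proof -
    have "(\<Sum>z\<leftarrow>?s x. 1 :: bit) = 1" if "x \<in> set w" for x
      using \<open>\<forall>x\<in>set w. bd x = []\<close> that
      by (auto simp: subdivide_letter_def subdivide_def bd_def cell_bd_def split: if_splits)
    then show ?thesis
      by (induction w) auto
  qed
  have "cobd (\<lambda>w. ev u (map ?s w)) w + of_bool (\<forall>x\<in>set w. bd x = [])
      = ev (cobd u) (map ?s w) + ev (\<lambda>w'. of_bool (\<forall>x\<in>set w. bd x = [])) (map ?s w)"
  proof -
    have "cobd (\<lambda>w. ev u (map ?s w)) w = ev (cobd u) (map ?s w)"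
      by (rule cobd_ev) (use w assms(1) pt in \<open>intro bd_subdivide_letter; blast\<close>)
    then show ?thesis
      using one by (cases "\<forall>x\<in>set w. bd x = []") auto
  qed
  also have "\<dots> = ev (\<lambda>w'. cobd u w' + of_bool (\<forall>x\<in>set w'. bd x = [])) (map ?s w)"
    unfolding ev_add[symmetric] by (rule ev_cong) (simp add: dim list.rel_map)
  also have "\<dots> = ev (\<lambda>w'. u w' + u (map prod.swap w')) (map ?s w)"
    by (rule ev_cong) (use u[OF w] in \<open>simp add: list.rel_map\<close>)
  also have "\<dots> = ev u (map ?s w) + ev u (map ?s (map prod.swap w))"
    unfolding ev_add by (subst ev_map_letters[where t' = prod.swap]) (simp_all only: subdivide_letter_swap)
  finally show "cobd (\<lambda>w. ev u (map ?s w)) w + of_bool (\<forall>x\<in>set w. bd x = [])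
      = ev u (map ?s w) + ev u (map ?s (map prod.swap w))" .
qed

section \<open>The obstruction to embedding\<close>

lemma subdivide_segment:
  fixes pt :: "'a \<Rightarrow> 'b::real_normed_vector"
  assumes "z \<in> set (subdivide m pt c)"
  shows "fst z \<in> closed_segment (pt (fst c)) (pt (snd c))" (is ?thesis1)
    and "snd z \<in> closed_segment (pt (fst c)) (pt (snd c))" (is ?thesis2)
    and "dist (fst z) (snd z) \<le> dist (pt (fst c)) (pt (snd c)) / real m" (is ?thesis3)
proof -
  have seg: "P + t *\<^sub>R (Q - P) \<in> closed_segment P Q" if "0 \<le> t" "t \<le> 1" for P Q :: 'b and t
    using that by (auto simp: in_segment algebra_simps intro!: exI[of _ t])
  have "?thesis1 \<and> ?thesis2 \<and> ?thesis3"
  proof (cases "fst c = snd c")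
    case False
    then obtain j where j: "j < m"
      "z = (pt (fst c) + (real j / real m) *\<^sub>R (pt (snd c) - pt (fst c)),
            pt (fst c) + (real (Suc j) / real m) *\<^sub>R (pt (snd c) - pt (fst c)))"
      using assms by (auto simp: subdivide_def)
    have "fst z - snd z = (real j / real m - real (Suc j) / real m) *\<^sub>R (pt (snd c) - pt (fst c))"
      unfolding j(2) by (simp add: scaleR_diff_left)
    also have "real j / real m - real (Suc j) / real m = - (1 / real m)"
      by (simp add: diff_divide_distrib[symmetric])
    finally have "dist (fst z) (snd z) = dist (pt (fst c)) (pt (snd c)) / real m"
      by (simp add: dist_norm norm_minus_commute)
    moreover have ?thesis1 ?thesis2
      using j(1) unfolding j(2) fst_conv snd_conv by (intro seg; simp)+
    ultimately show ?thesis by simp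
  qed (use assms in \<open>simp add: subdivide_def\<close>)
  then show ?thesis1 ?thesis2 ?thesis3
    by auto
qed

lemma inner_segments_eq_0:
  fixes x y :: "'b::real_inner"
  assumes "x \<in> closed_segment a b" "y \<in> closed_segment c d"
    and "a \<bullet> c = 0" "a \<bullet> d = 0" "b \<bullet> c = 0" "b \<bullet> d = 0"
  shows "x \<bullet> y = 0"
  using assms by (auto simp: in_segment inner_simps)

lemma dist_vec_le:
  fixes x y :: "'a::metric_space ^ 'n::finite"
  assumes "\<And>i. dist (x $ i) (y $ i) \<le> r"
  shows "dist x y \<le> real CARD('n) * r"
proof -
  have "dist x y \<le> (\<Sum>i\<in>UNIV. dist (x $ i) (y $ i))"
    unfolding dist_vec_def by (rule L2_set_le_sum) simp
  also have "\<dots> \<le> (\<Sum>i\<in>(UNIV :: 'n set). r)"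
    by (rule sum_mono) (rule assms)
  finally show ?thesis by simp
qed

lemma compact_cartesian_power:
  fixes K :: "'a::euclidean_space set"
  assumes "compact K"
  shows "compact (cartesian_power K :: ('a ^ 'n::finite) set)"
proof -
  have "closed ((\<lambda>x :: 'a ^ 'n. x $ i) -` K)" for i
    using assms by (intro closed_vimage compact_imp_closed) (auto intro: continuous_intros)
  then have "closed (\<Inter>i. (\<lambda>x :: 'a ^ 'n. x $ i) -` K)"
    by blast
  moreover have "(\<Inter>i. (\<lambda>x :: 'a ^ 'n. x $ i) -` K) = cartesian_power K"
    by (auto simp: cartesian_power_def)
  moreover obtain B where "\<And>x. x \<in> K \<Longrightarrow> norm x \<le> B"
    using compact_imp_bounded[OF assms] by (auto simp: bounded_iff)
  then have "dist 0 x \<le> real CARD('n) * B" if "x \<in> cartesian_power K" for x :: "'a ^ 'n"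
    using that by (intro dist_vec_le) (simp add: cartesian_power_def)
  then have "bounded (cartesian_power K :: ('a ^ 'n) set)"
    unfolding bounded_def by blast
  ultimately show ?thesis
    by (simp add: compact_eq_bounded_closed)
qed

text \<open>Orthogonality in one coordinate is a closed condition that holds on pairs of disjoint
  cells. As 0 is not in K, it forces x and y to differ, so the distance of the images has a positive
  minimum on a compact set.\<close>

lemma uniform_separation:
  fixes f :: "'a::euclidean_space ^ 'n::finite \<Rightarrow> 'b::real_normed_vector"
  assumes K: "compact K" "0 \<notin> K"
    and f: "continuous_on (cartesian_power K) f" "inj_on f (cartesian_power K)"
  obtains \<delta> where "\<delta> > 0" "\<And>x y i. x \<in> cartesian_power K \<Longrightarrow> y \<in> cartesian_power K \<Longrightarrow>
    x $ i \<bullet> y $ i = 0 \<Longrightarrow> \<delta> \<le> norm (f x - f y)"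
proof -
  define D where "D = (\<Union>i. (cartesian_power K \<times> cartesian_power K) \<inter> {z :: ('a ^ 'n) \<times> ('a ^ 'n). fst z $ i \<bullet> snd z $ i = 0})"
  have "compact (cartesian_power K \<times> cartesian_power K :: (('a ^ 'n) \<times> ('a ^ 'n)) set)"
    by (intro compact_Times compact_cartesian_power K)
  moreover have "closed {z :: ('a ^ 'n) \<times> ('a ^ 'n). fst z $ i \<bullet> snd z $ i = 0}" for i
    by (intro closed_Collect_eq continuous_intros)
  ultimately have "compact D"
    unfolding D_def by (intro compact_UN compact_Int_closed) auto
  moreover have "continuous_on D (\<lambda>z. norm (f (fst z) - f (snd z)))"
    by (intro continuous_intros continuous_on_compose2[OF f(1)]) (auto simp: D_def)
  moreover have pos: "norm (f (fst z) - f (snd z)) > 0" if z: "z \<in> D" for z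
  proof -
    obtain i where i: "fst z \<in> cartesian_power K" "snd z \<in> cartesian_power K" "fst z $ i \<bullet> snd z $ i = 0"
      using z by (auto simp: D_def)
    then have "fst z $ i \<in> K"
      by (simp add: cartesian_power_def)
    then have "fst z $ i \<noteq> 0"
      using K(2) by auto
    then have "fst z \<noteq> snd z"
      using i(3) by auto
    then show ?thesis
      using inj_onD[OF f(2)] i by fastforce
  qed
  ultimately have "\<exists>\<delta>>0. \<forall>z\<in>D. \<delta> \<le> norm (f (fst z) - f (snd z))"
  proof (cases "D = {}")
    case False
    then obtain z where "z \<in> D" "\<forall>y\<in>D. norm (f (fst z) - f (snd z)) \<le> norm (f (fst y) - f (snd y))"
      using continuous_attains_inf[OF \<open>compact D\<close> _ \<open>continuous_on D _\<close>] by blast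
    then show ?thesis
      using pos by blast
  qed (auto intro: zero_less_one)
  then obtain \<delta> where \<delta>: "\<delta> > 0" "\<And>z. z \<in> D \<Longrightarrow> \<delta> \<le> norm (f (fst z) - f (snd z))"
    by blast
  show ?thesis
  proof (rule that[OF \<delta>(1)])
    fix x y :: "'a ^ 'n" and i
    assume "x \<in> cartesian_power K" "y \<in> cartesian_power K" "x $ i \<bullet> y $ i = 0"
    then have "(x, y) \<in> D"
      by (auto simp: D_def)
    then show "\<delta> \<le> norm (f x - f y)"
      using \<delta>(2)[of "(x, y)"] by simp
  qed
qed

context tripod_cycle
begin

text \<open>Only continuity of f is used. Realising vertices as basis vectors makes disjoint cells
  orthogonal, as \<open>uniform_separation\<close> requires.\<close>

lemma cartesian_power_not_embeddable:
  fixes h :: "'a \<Rightarrow> 'v::finite" and K :: "(real ^ 'v) set"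
    and f :: "(real ^ 'v) ^ 'n::finite \<Rightarrow> real ^ 'm::finite"
  defines "pt \<equiv> \<lambda>a. axis (h a) 1"
  assumes G: "G = C \<times> C"
    and h: "inj_on h (fst ` C \<union> snd ` C)"
    and segments: "\<And>c. c \<in> C \<Longrightarrow> closed_segment (pt (fst c)) (pt (snd c)) \<subseteq> K"
    and v_edges: "\<And>x. x \<in> set v \<Longrightarrow> fst (fst x) \<noteq> snd (fst x) \<and> fst (snd x) \<noteq> snd (snd x)"
    and K: "compact K" "0 \<notin> K"
    and f: "continuous_on (cartesian_power K) f"
    and card: "CARD('m) = 2 * CARD('n)"
  shows "\<not> inj_on f (cartesian_power K)"
proof
  assume inj: "inj_on f (cartesian_power K)"
  define n where "n = CARD('n)"
  obtain idx :: "'n \<Rightarrow> nat" where idx: "bij_betw idx UNIV {..<n}"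
    by (metis atLeast0LessThan ex_bij_betw_finite_nat finite n_def)
  obtain e :: "nat \<Rightarrow> 'm" where e: "bij_betw e {..<2 * n} UNIV"
    by (metis atLeast0LessThan card ex_bij_betw_nat_finite finite n_def)
  obtain \<delta> where \<delta>: "\<delta> > 0" "\<And>x y i. x \<in> cartesian_power K \<Longrightarrow> y \<in> cartesian_power K \<Longrightarrow>
    x $ i \<bullet> y $ i = 0 \<Longrightarrow> \<delta> \<le> norm (f x - f y)"
    using uniform_separation[OF K f inj] by blast
  \<comment> \<open>The norm is at most the sum of the 2 n absolute coordinates, so a vector of norm
    at least \<delta> has a coordinate of size at least \<delta> / (2 n).\<close>
  define \<epsilon> where "\<epsilon> = \<delta> / (2 * n)"
  have n: "n > 0" by (simp add: n_def)
  then have "\<epsilon> > 0" using \<delta> by (simp add: \<epsilon>_def)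
  have "compact (cartesian_power K :: ((real ^ 'v) ^ 'n) set)"
    by (rule compact_cartesian_power[OF K(1)])
  then have "uniformly_continuous_on (cartesian_power K) f"
    using f by (rule compact_uniformly_continuous[rotated])
  then obtain \<eta> where \<eta>: "\<eta> > 0" "\<And>x y. x \<in> cartesian_power K \<Longrightarrow> y \<in> cartesian_power K \<Longrightarrow>
      dist x y < \<eta> \<Longrightarrow> dist (f x) (f y) < \<epsilon> / 2"
    using \<open>\<epsilon> > 0\<close> unfolding uniformly_continuous_on_def by (metis half_gt_zero)
  \<comment> \<open>Two basis vectors are at distance at most 2, so corners of a small cube differ
    by at most 2 / m in each of the n coordinates.\<close>
  obtain m :: nat where m: "m > 0" "real n * (2 / real m) < \<eta>"
  proof -
    obtain m :: nat where "real n * 2 / \<eta> < real m"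
      using reals_Archimedean2 by blast
    moreover from this have "m > 0"
      using \<eta> n by (cases m) (auto simp: field_simps)
    ultimately show ?thesis
      using that[of m] \<eta> by (simp add: field_simps)
  qed
  define X Y :: "(nat \<times> bool \<Rightarrow> real ^ 'v) \<Rightarrow> (real ^ 'v) ^ 'n"
    where "X y = (\<chi> i. y (idx i, False))" and "Y y = (\<chi> i. y (idx i, True))" for y
  define F where "F y j = (f (X y) - f (Y y)) $ e j" for y j
  \<comment> \<open>The choice depends only on absolute values, hence is the same for (x, y) and (y,
    x); only the sign in the label changes.\<close>
  define L where "L y = (LEAST j. j < 2 * n \<and> \<epsilon> \<le> \<bar>F y j\<bar>)" for y
  define \<Lambda> where "\<Lambda> y = (L y, F y (L y) > 0)" for y
  define s where "s = subdivide_letter m pt"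
  define u where "u w = ev (cube_sum (\<lambda>l. fan (2 * n) (map \<Lambda> l))) (map s w)" for w
  have h_eq: "h a = h b \<longleftrightarrow> a = b" if "a \<in> fst ` C \<union> snd ` C" "b \<in> fst ` C \<union> snd ` C" for a b
    using h that by (auto dest: inj_onD)
  have pt: "pt (fst c) \<noteq> pt (snd c)" if "x \<in> G" "c = fst x \<or> c = snd x" "fst c \<noteq> snd c" for x c
  proof -
    have "c \<in> C"
      using that G by auto
    then show ?thesis
      using that(3) h_eq[of "fst c" "snd c"] by (simp add: pt_def axis_eq_axis)
  qed
  have X_flip: "X (y \<circ> flip) = Y y" "Y (y \<circ> flip) = X y" for y
    by (simp_all add: X_def Y_def flip_def o_def)
  have F_flip: "F (y \<circ> flip) j = - F y j" for y j
    by (simp add: F_def X_flip)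
  have L_flip: "L (y \<circ> flip) = L y" for y
    by (simp add: L_def F_flip)
  have "antisym_cochain G n u"
    unfolding u_def s_def
  proof (rule antisym_cochain_subdivide[OF m(1) pt])
    fix w w' assume w: "length w = n" "set w \<subseteq> G" "\<exists>x\<in>set w. disjoint_cells x"
      and "list_all2 (\<lambda>z p. z \<in> set (subdivide_letter m pt p)) w' w"
    then have len: "length w' = n" and w': "w' ! i \<in> set (subdivide_letter m pt (w ! i))" if "i < n" for i
      using that by (auto simp: list_all2_conv_all_nth)
    have "coord w' (i, b) \<in> set (subdivide m pt (coord w (i, b)))" if "i < n" for i b
      using w'[OF that] that len w(1) by (auto simp: coord_def subdivide_letter_def)
    note seg = subdivide_segment[OF this]
    have coord_C: "coord w k \<in> C" if "fst k < n" for k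
    proof -
      have "w ! fst k \<in> C \<times> C"
        using that w nth_mem[of "fst k" w] G by blast
      then show ?thesis
        using that w(1) by (auto simp: coord_def)
    qed
    have vertex: "y k = fst (coord w' k) \<or> y k = snd (coord w' k)" if "y \<in> vertices w'" for y k
      using that unfolding vertices_def lower_def upper_def by blast
    have near: "y (i, b) \<in> closed_segment (pt (fst (coord w (i, b)))) (pt (snd (coord w (i, b))))"
      if "y \<in> vertices w'" "i < n" for y i b
      using vertex[OF that(1), of "(i, b)"] seg(1,2)[OF that(2), of b] by auto
    have in_K: "y (i, b) \<in> K" if "y \<in> vertices w'" "i < n" for y i b
      using near[OF that] segments[OF coord_C] that by fastforce
    have idx_less: "idx i < n" for i
      using idx by (auto simp: bij_betw_def)
    have XY: "X y \<in> cartesian_power K" "Y y \<in> cartesian_power K" if "y \<in> vertices w'" for y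
      using in_K[OF that] idx_less by (auto simp: cartesian_power_def X_def Y_def)
    obtain i where i: "i < n" "disjoint_cells (w ! i)"
      using w by (auto simp: in_set_conv_nth)
    have orth: "y (i, False) \<bullet> y (i, True) = 0" if "y \<in> vertices w'" for y
    proof (rule inner_segments_eq_0[OF near[OF that i(1)] near[OF that i(1)]])
      have "pt a \<bullet> pt b = 0"
        if "a \<in> {fst (coord w (i, False)), snd (coord w (i, False))}"
          "b \<in> {fst (coord w (i, True)), snd (coord w (i, True))}" for a b
      proof -
        have "a \<in> fst ` C \<union> snd ` C" "b \<in> fst ` C \<union> snd ` C"
          using i(1) that coord_C[of "(i, False)"] coord_C[of "(i, True)"] by auto
        moreover have "a \<noteq> b"
          using i w(1) that by (auto simp: disjoint_cells_def coord_def)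
        ultimately have "h a \<noteq> h b"
          using h_eq by blast
        then show ?thesis
          by (simp add: pt_def inner_axis_axis)
      qed
      then show "pt (fst (coord w (i, False))) \<bullet> pt (fst (coord w (i, True))) = 0"
        "pt (fst (coord w (i, False))) \<bullet> pt (snd (coord w (i, True))) = 0"
        "pt (snd (coord w (i, False))) \<bullet> pt (fst (coord w (i, True))) = 0"
        "pt (snd (coord w (i, False))) \<bullet> pt (snd (coord w (i, True))) = 0"
        by auto
    qed
    have L: "L y < 2 * n \<and> \<epsilon> \<le> \<bar>F y (L y)\<bar>" if "y \<in> vertices w'" for y
    proof -
      obtain i' where i': "idx i' = i"
        using idx i(1) by (metis bij_betw_def imageE lessThan_iff)
      have "\<delta> \<le> norm (f (X y) - f (Y y))"
        using \<delta>(2)[OF XY[OF that], of i'] orth[OF that] by (simp add: X_def Y_def i')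
      also have "\<dots> \<le> (\<Sum>k\<in>UNIV. \<bar>(f (X y) - f (Y y)) $ k\<bar>)"
        by (rule norm_le_l1_cart)
      also have "\<dots> = (\<Sum>j<2 * n. \<bar>F y j\<bar>)"
        unfolding F_def by (rule sum.reindex_bij_betw[OF e, symmetric])
      finally have "\<exists>j<2 * n. \<epsilon> \<le> \<bar>F y j\<bar>"
        using sum_strict_mono[of "{..<2 * n}" "\<lambda>j. \<bar>F y j\<bar>" "\<lambda>_. \<epsilon>"] n
        by (fastforce simp: \<epsilon>_def not_le)
      then show ?thesis
        unfolding L_def by (metis (mono_tags, lifting) LeastI_ex)
    qed
    have close: "\<bar>F y j - F z j\<bar> < \<epsilon>" if "y \<in> vertices w'" "z \<in> vertices w'" for y z j
    proof -
      have d: "dist (y (i, b)) (z (i, b)) \<le> 2 / real m" if "i < n" for i b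
      proof -
        have "dist (pt a) (pt b) \<le> 2" for a b
          using norm_triangle_ineq4[of "pt a" "pt b"] by (simp add: dist_norm pt_def)
        then have "dist (fst (coord w' (i, b))) (snd (coord w' (i, b))) \<le> 2 / real m"
          using seg(3)[OF that, of b] by (smt (verit) divide_right_mono of_nat_0_le_iff)
        then show ?thesis
          using vertex[OF \<open>y \<in> _\<close>, of "(i, b)"] vertex[OF \<open>z \<in> _\<close>, of "(i, b)"] by (auto simp: dist_commute)
      qed
      have dist_XY: "dist (X y) (X z) \<le> real n * (2 / real m)" "dist (Y y) (Y z) \<le> real n * (2 / real m)"
        unfolding n_def by (rule dist_vec_le; simp add: X_def Y_def d idx_less)+
      have "dist (f (X y)) (f (X z)) < \<epsilon> / 2" "dist (f (Y y)) (f (Y z)) < \<epsilon> / 2"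
        by (intro \<eta>(2) XY that le_less_trans[OF dist_XY(1) m(2)] le_less_trans[OF dist_XY(2) m(2)])+
      moreover have "\<bar>F y j - F z j\<bar> \<le> \<bar>(f (X y) - f (X z)) $ e j\<bar> + \<bar>(f (Y y) - f (Y z)) $ e j\<bar>"
        unfolding F_def by (simp add: vector_minus_component)
      ultimately show ?thesis
        using component_le_norm_cart[of "f (X y) - f (X z)" "e j"] component_le_norm_cart[of "f (Y y) - f (Y z)" "e j"]
        unfolding dist_norm by linarith
    qed
    show "cobd (cube_sum (\<lambda>l. fan (2 * n) (map \<Lambda> l))) w' + of_bool (\<forall>x\<in>set w'. bd x = [])
      = cube_sum (\<lambda>l. fan (2 * n) (map \<Lambda> l)) w' + cube_sum (\<lambda>l. fan (2 * n) (map \<Lambda> l)) (map prod.swap w')"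
    proof (rule cobd_cube_sum_fan)
      fix y assume y: "y \<in> vertices w'"
      show "fst (\<Lambda> y) < 2 * n"
        using L[OF y] by (simp add: \<Lambda>_def)
      show "\<Lambda> (y \<circ> flip) = neg (\<Lambda> y)"
        using L[OF y] \<open>\<epsilon> > 0\<close> by (auto simp: \<Lambda>_def neg_def L_flip F_flip)
      fix z assume z: "z \<in> vertices w'"
      \<comment> \<open>Opposite labels would give values of one coordinate with opposite signs and
        sizes at least \<epsilon>, which \<open>close\<close> forbids within a small cube.\<close>
      show "\<Lambda> z \<noteq> neg (\<Lambda> y)"
        using L[OF y] L[OF z] close[OF y z, of "L y"] \<open>\<epsilon> > 0\<close> by (auto simp: \<Lambda>_def neg_def)
    qed
  qed
  then have "ev u (replicate n v) + ev u (replicate n (map prod.swap v)) = 1"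
    using n by (intro ev_antisym_cochain) auto
  \<comment> \<open>All letters of v are pairs of edges, so each small cube has 2 n axes and its
    simplices have one vertex too many to alternate.\<close>
  moreover have "ev u (replicate n v') = 0" if v': "v' = v \<or> v' = map prod.swap v" for v'
  proof -
    have edges: "fst (fst x) \<noteq> snd (fst x) \<and> fst (snd x) \<noteq> snd (snd x)" if "x \<in> set v'" for x
      using that v' v_edges by fastforce
    have v'_G: "set v' \<subseteq> G"
      using v' v_G G_swap by auto
    have "u w = 0" if w: "list_all2 (\<lambda>x a. x \<in> set a) w (replicate n v')" for w
    proof -
      note w_G = words_in_G[OF w v'_G]
      have "cube_sum (\<lambda>l. fan (2 * n) (map \<Lambda> l)) w' = 0" if "list_all2 (\<lambda>z p. z \<in> set (s p)) w' w" for w'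
      proof (rule cube_sum_fan_eq_0)
        have "{..<n} \<times> UNIV \<subseteq> axes w'"
        proof
          fix k :: "nat \<times> bool" assume "k \<in> {..<n} \<times> UNIV"
          then have k: "fst k < n" by auto
          then have "w ! fst k \<in> set v'" "w ! fst k \<in> G" "length w' = n"
            "w' ! fst k \<in> set (subdivide_letter m pt (w ! fst k))"
            using w w_G that by (auto simp: list_all2_conv_all_nth s_def)
          with subdivide_letter_degenerate_iff[OF this(4) pt[OF this(2)]] edges[OF this(1)] k
          show "k \<in> axes w'"
            by (auto simp: axes_def lower_def upper_def coord_def)
        qed
        then have "card ({..<n} \<times> (UNIV :: bool set)) \<le> card (axes w')"
          by (intro card_mono) auto
        then show "2 * n \<le> card (axes w')"
          by (simp add: card_cartesian_product)
      qed
      then have "u w = ev (\<lambda>w'. 0) (map s w)"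
        unfolding u_def by (intro ev_cong) (simp add: list.rel_map)
      then show ?thesis by simp
    qed
    then have "ev u (replicate n v') = ev (\<lambda>w. 0) (replicate n v')"
      by (intro ev_cong) auto
    then show ?thesis by simp
  qed
  ultimately show False by simp
qed

end

section \<open>Piecewise linear maps and the two graphs\<close>

lemma pl_map_on_imp_continuous_on:
  assumes "pl_map_on K f"
  shows "continuous_on K f"
proof -
  obtain T where T: "simplicial_complex T" "\<Union>T = K"
    and affine: "\<And>S. S \<in> T \<Longrightarrow> \<exists>h c. linear h \<and> (\<forall>x\<in>S. f x = h x + c)"
    using assms by (auto simp: pl_map_on_def)
  have "continuous_on (\<Union>S\<in>T. S) f"
  proof (rule continuous_on_closed_Union)
    fix S assume S: "S \<in> T"
    then show "closed S"
      using T(1) by (auto simp: simplicial_complex_def intro: closed_simplex)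
    obtain h c where "linear h" "\<forall>x\<in>S. f x = h x + c"
      using affine[OF S] by blast
    moreover from this have "continuous_on S (\<lambda>x. h x + c)"
      by (intro continuous_on_add linear_continuous_on linear_conv_bounded_linear[THEN iffD1] continuous_on_const)
    ultimately show "continuous_on S f"
      by (simp cong: continuous_on_cong)
  qed (use T(1) in \<open>simp add: simplicial_complex_def\<close>)
  then show ?thesis
    using T(2) by simp
qed

lemma compact_graph_polyhedron:
  fixes E :: "'v::finite set set"
  shows "compact (graph_polyhedron E)"
  unfolding graph_polyhedron_def
  by (intro compact_Un compact_UN finite_imp_compact compact_convex_hull) (auto intro: finite_subset[of _ UNIV])

text \<open>The graph lies in the hyperplane of vectors with coordinate sum 1.\<close>

lemma zero_not_in_graph_polyhedron:
  fixes E :: "'v::finite set set"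
  shows "0 \<notin> graph_polyhedron E"
proof -
  define H :: "(real ^ 'v) set" where "H = {x. (\<chi> i. 1) \<bullet> x = 1}"
  have axis: "axis v 1 \<in> H" for v
    by (simp add: H_def inner_axis)
  have "convex H"
    unfolding H_def by (rule convex_hyperplane)
  then have "convex hull ((\<lambda>v. axis v 1) ` e) \<subseteq> H" for e
    using axis by (intro hull_minimal) auto
  then have "graph_polyhedron E \<subseteq> H"
    using axis by (auto simp: graph_polyhedron_def)
  then show ?thesis
    by (auto simp: H_def)
qed

lemma edge_subset_graph_polyhedron:
  assumes "a = b \<or> {a, b} \<in> E"
  shows "closed_segment (axis a 1) (axis b 1) \<subseteq> graph_polyhedron E"
proof (cases "a = b")
  case False
  then have "convex hull ((\<lambda>v. axis v 1) ` {a, b}) \<subseteq> graph_polyhedron E"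
    using assms unfolding graph_polyhedron_def by blast
  then show ?thesis
    by (simp add: segment_convex_hull)
qed (auto simp: graph_polyhedron_def)

lemma (in tripod_cycle) not_pl_embeddable_cartesian_power:
  fixes h :: "'a \<Rightarrow> 'v::finite"
  assumes G: "G = C \<times> C"
    and h: "inj_on h (fst ` C \<union> snd ` C)"
    and edges: "\<And>c. c \<in> C \<Longrightarrow> fst c = snd c \<or> {h (fst c), h (snd c)} \<in> E"
    and v_edges: "\<And>x. x \<in> set v \<Longrightarrow> fst (fst x) \<noteq> snd (fst x) \<and> fst (snd x) \<noteq> snd (snd x)"
    and card: "CARD('m::finite) = 2 * CARD('n::finite)"
  shows "\<not> pl_embeddable (cartesian_power (graph_polyhedron E) :: ((real ^ 'v) ^ 'n) set) (UNIV :: (real ^ 'm) set)"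
proof
  assume "pl_embeddable (cartesian_power (graph_polyhedron E) :: ((real ^ 'v) ^ 'n) set) (UNIV :: (real ^ 'm) set)"
  then obtain f :: "(real ^ 'v) ^ 'n \<Rightarrow> real ^ 'm" where f: "pl_map_on (cartesian_power (graph_polyhedron E)) f"
    and inj: "inj_on f (cartesian_power (graph_polyhedron E))"
    by (auto simp: pl_embeddable_def)
  have "closed_segment (axis (h (fst c)) 1) (axis (h (snd c)) 1) \<subseteq> graph_polyhedron E" if "c \<in> C" for c
    using edges[OF that] by (intro edge_subset_graph_polyhedron) auto
  from cartesian_power_not_embeddable[OF G h this v_edges compact_graph_polyhedron zero_not_in_graph_polyhedron
      pl_map_on_imp_continuous_on[OF f] card]
  show False
    using inj by blast
qed

theorem mainTheorem2:
  fixes N :: nat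
  assumes "N \<ge> 1"
    and "CARD('n::finite) = N"
    and "CARD('m::finite) = 2 * N"
  shows "\<not> pl_embeddable (cartesian_power K5 :: ((real ^ 5) ^ 'n) set) (UNIV :: (real ^ 'm) set) \<and>
         \<not> pl_embeddable (cartesian_power K33 :: ((real ^ (3 + 3)) ^ 'n) set) (UNIV :: (real ^ 'm) set)"
proof
  have card: "CARD('m) = 2 * CARD('n)"
    using assms by simp
  obtain g :: "nat \<Rightarrow> 5" where g: "bij_betw g {0..<CARD(5)} UNIV"
    using ex_bij_betw_nat_finite[of "UNIV :: 5 set"] by auto
  have g_eq: "g a = g b \<longleftrightarrow> a = b" if "a < 5" "b < 5" for a b
    using bij_betw_imp_inj_on[OF g] that by (auto dest: inj_onD)
  show "\<not> pl_embeddable (cartesian_power K5 :: ((real ^ 5) ^ 'n) set) (UNIV :: (real ^ 'm) set)"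
    unfolding K5_def
  proof (rule K5.not_pl_embeddable_cartesian_power[OF refl _ _ _ card])
    show "inj_on g (fst ` K5_cells \<union> snd ` K5_cells)"
      by (rule inj_onI) (auto simp: K5_cells_def g_eq)
    show "fst c = snd c \<or> {g (fst c), g (snd c)} \<in> {{u, v} |u v. u \<noteq> v}" if "c \<in> K5_cells" for c
      using that by (auto simp: K5_cells_def) (metis g_eq le_less_trans)
    show "fst (fst x) \<noteq> snd (fst x) \<and> fst (snd x) \<noteq> snd (snd x)" if "x \<in> set K5_cycle" for x
      using that by (auto simp: K5_cycle_def triangle_def)
  qed
  obtain k :: "nat \<Rightarrow> 3" where k: "bij_betw k {0..<CARD(3)} UNIV"
    using ex_bij_betw_nat_finite[of "UNIV :: 3 set"] by auto
  have k_eq: "k a = k b \<longleftrightarrow> a = b" if "a < 3" "b < 3" for a b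
    using bij_betw_imp_inj_on[OF k] that by (auto dest: inj_onD)
  define h :: "nat \<Rightarrow> 3 + 3" where "h a = (if a < 3 then Inl (k a) else Inr (k (a - 3)))" for a
  have h_eq: "h a = h b \<longleftrightarrow> a = b" if "a < 6" "b < 6" for a b
    using that k_eq[of a b] k_eq[of "a - 3" "b - 3"] by (auto simp: h_def)
  show "\<not> pl_embeddable (cartesian_power K33 :: ((real ^ (3 + 3)) ^ 'n) set) (UNIV :: (real ^ 'm) set)"
    unfolding K33_def
  proof (rule K33.not_pl_embeddable_cartesian_power[OF refl _ _ _ card])
    show "inj_on h (fst ` K33_cells \<union> snd ` K33_cells)"
      by (rule inj_onI) (auto simp: K33_cells_def h_eq)
    show "fst c = snd c \<or> {h (fst c), h (snd c)} \<in> {{Inl i, Inr j} |i j. True}" if "c \<in> K33_cells" for c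
      using that by (auto simp: K33_cells_def h_def)
    show "fst (fst x) \<noteq> snd (fst x) \<and> fst (snd x) \<noteq> snd (snd x)" if "x \<in> set K33_cycle" for x
      using that by (auto simp: K33_cycle_def square_def)
  qed
qed

end
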